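(* Let $\gamma>0$ and set $\sigma_l=|l|^{-1/2-\gamma}$ (with $\sigma_0=1$ if $0\in\mathcal L$) or $\sigma_l=2^{-(1/2+\gamma)l}$ depending on whether the chosen $S$-regular basis $\{\psi_{lk}\}$ of $L^2$ is of type (a) or (b), respectively. Let $f_0\in L^2$ be fixed with coefficients $\theta_{0,lk}=\langle f_0,\psi_{lk}\rangle$ and let $\Pi=\bigotimes_{l,k}\pi_{lk}$ be a product prior on the coefficients $\theta_{lk}=\langle f,\psi_{lk}\rangle$, where $\pi_{lk}$ has Lebesgue density $\varphi_{lk}(\cdot)=\sigma_l^{-1}\varphi(\cdot/\sigma_l)$ for a fixed probability density $\varphi$ on $\mathbb R$. Suppose: (P1) for a finite constant $M>0$, $\sup_{l\in\mathcal L,k\in\mathcal Z_l}|\theta_{0,lk}|/\sigma_l\le M$; (P2) for some $\tau>M$ and $0<c_\varphi\le C_\varphi<\infty$: $\varphi(x)\le C_\varphi$ for all $x\in\mathbb R$, $\varphi(x)\ge c_\varphi$ for all $x\in(-\tau,\tau)$, and $\int_{\mathbb R}x^2\varphi(x)\,dx<\infty$. Then, as $n\to\infty$, $$E_{f_0}^n\int\|f-f_0\|_2^2\,d\Pi(f\mid\mathbb X^{(n)})=O\big(n^{-2\gamma/(2\gamma+1)}\big).$$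
   Context: Basis. $L^2=L^2([0,1])$, $\langle f,g\rangle=\int_0^1 f\bar g$. Let $S\in\mathbb N$. An $S$-regular orthonormal basis $\{\psi_{lk}: l\in\mathcal L,k\in\mathcal Z_l\}$ of $L^2$ ($\mathcal L,\mathcal Z_l\subset\mathbb Z$) is one for which every $\psi_{lk}$ is $S$-times differentiable with all derivatives in $L^2$ and either (type (a)) $|\mathcal Z_l|=1$ for all $l\in\mathcal L$, or (type (b)) $\mathcal L\subset\mathbb N=\{1,2,\dots\}$ and $|\mathcal Z_l|=2^l$. Coefficients are treated as real. Model. For $f\in L^2$ one observes $dX^{(n)}(t)=f(t)dt+n^{-1/2}dW(t)$, $t\in[0,1]$, with $dW$ standard white noise; equivalently $\mathbb X^{(n)}=(\mathbb X^{(n)}_{lk})$ with $\mathbb X^{(n)}_{lk}=\theta_{lk}+n^{-1/2}\varepsilon_{lk}$, $\theta_{lk}=\langle f,\psi_{lk}\rangle$, $\varepsilon_{lk}$ i.i.d. $N(0,1)$. The law is $P_f^n$, with expectation $E_f^n$. $\Pi(\cdot\mid\mathbb X^{(n)})$ is the posterior, i.e. the conditional law of $f$ given $\mathbb X^{(n)}$ when $f\sim\Pi$, $\mathbb X^{(n)}\mid f\sim P_f^n$ (for product priors: the product over $(l,k)$ of the densities proportional to $\theta\mapsto e^{-n(\mathbb X^{(n)}_{lk}-\theta)^2/2}\varphi_{lk}(\theta)$). Data are generated under $P_{f_0}^n$. *)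

theory Defs
  imports "HOL-Probability.Probability" "HOL-Library.Landau_Symbols"
begin

text \<open>
  Elements of \<open>L\<^sup>2([0,1])\<close> are represented by complex-valued functions; two functions that agree
  almost everywhere on \<open>[0,1]\<close> represent the same element, and values outside \<open>[0,1]\<close> are ignored.
\<close>

definition L2 :: "(real \<Rightarrow> complex) set" where
  "L2 = {f. f \<in> borel_measurable (lebesgue_on {0..1}) \<and>
            integrable (lebesgue_on {0..1}) (\<lambda>t. (norm (f t))\<^sup>2)}"

definition L2_inner :: "(real \<Rightarrow> complex) \<Rightarrow> (real \<Rightarrow> complex) \<Rightarrow> complex" where
  "L2_inner f g = (\<integral>t. f t * cnj (g t) \<partial>lebesgue_on {0..1})"

definition L2_sqdist :: "(real \<Rightarrow> complex) \<Rightarrow> (real \<Rightarrow> complex) \<Rightarrow> ennreal" where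
  "L2_sqdist f g = (\<integral>\<^sup>+t. ennreal ((norm (f t - g t))\<^sup>2) \<partial>lebesgue_on {0..1})"

definition orthonormal_basis :: "'i set \<Rightarrow> ('i \<Rightarrow> real \<Rightarrow> complex) \<Rightarrow> bool" where
  "orthonormal_basis I \<psi> \<longleftrightarrow>
     (\<forall>i\<in>I. \<psi> i \<in> L2) \<and>
     (\<forall>i\<in>I. \<forall>j\<in>I. L2_inner (\<psi> i) (\<psi> j) = (if i = j then 1 else 0)) \<and>
     (\<forall>f\<in>L2. \<forall>e>0. \<exists>F c. finite F \<and> F \<subseteq> I \<and>
        L2_sqdist f (\<lambda>t. \<Sum>i\<in>F. c i * \<psi> i t) < ennreal e)"

text \<open>Derivatives at the endpoints of \<open>[0,1]\<close> are one-sided.\<close>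

definition nth_deriv01 :: "nat \<Rightarrow> (real \<Rightarrow> complex) \<Rightarrow> real \<Rightarrow> complex" where
  "nth_deriv01 j = (\<lambda>g t. vector_derivative g (at t within {0..1})) ^^ j"

datatype basis_type = Type_A | Type_B

definition S_regular_basis ::
  "basis_type \<Rightarrow> nat \<Rightarrow> int set \<Rightarrow> (int \<Rightarrow> int set) \<Rightarrow> (int \<times> int \<Rightarrow> real \<Rightarrow> complex) \<Rightarrow> bool" where
  "S_regular_basis T S L Z \<psi> \<longleftrightarrow>
     orthonormal_basis (Sigma L Z) \<psi> \<and>
     (\<forall>i \<in> Sigma L Z.
        (\<forall>j<S. nth_deriv01 j (\<psi> i) differentiable_on {0..1}) \<and>
        (\<forall>j\<le>S. nth_deriv01 j (\<psi> i) \<in> L2)) \<and>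
     (case T of
        Type_A \<Rightarrow> (\<forall>l\<in>L. card (Z l) = 1)
      | Type_B \<Rightarrow> L \<subseteq> {1..} \<and> (\<forall>l\<in>L. card (Z l) = 2 ^ nat l))"

definition prior_scale :: "basis_type \<Rightarrow> real \<Rightarrow> int \<Rightarrow> real" where
  "prior_scale T \<gamma> l = (case T of
      Type_A \<Rightarrow> (if l = 0 then 1 else \<bar>of_int l\<bar> powr (- 1/2 - \<gamma>))
    | Type_B \<Rightarrow> 2 powr (- (1/2 + \<gamma>) * of_int l))"

text \<open>
  The law \<open>P\<^sub>f\<^sup>n\<close> of the sequence \<open>\<langle>f, \<psi>\<^sub>i\<rangle> + \<epsilon>\<^sub>i / sqrt n\<close> with i.i.d. standard normal \<open>\<epsilon>\<^sub>i\<close>.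
  Coefficients are assumed to be real wherever this is used, so taking real parts loses nothing.
\<close>

definition data_law ::
  "'i set \<Rightarrow> ('i \<Rightarrow> real \<Rightarrow> complex) \<Rightarrow> nat \<Rightarrow> (real \<Rightarrow> complex) \<Rightarrow> ('i \<Rightarrow> real) measure" where
  "data_law I \<psi> n f =
     distr (PiM I (\<lambda>_. density lborel std_normal_density)) (PiM I (\<lambda>_. borel))
       (\<lambda>\<epsilon>. \<lambda>i\<in>I. Re (L2_inner f (\<psi> i)) + \<epsilon> i / sqrt (real n))"

definition prior_density :: "(real \<Rightarrow> real) \<Rightarrow> real \<Rightarrow> real \<Rightarrow> real" where
  "prior_density \<phi> s x = \<phi> (x / s) / s"

definition coord_posterior :: "nat \<Rightarrow> (real \<Rightarrow> real) \<Rightarrow> real \<Rightarrow> real measure" where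
  "coord_posterior n p x = density lborel (\<lambda>u. ennreal
     (exp (- real n * (x - u)\<^sup>2 / 2) * p u /
       (\<integral>v. exp (- real n * (x - v)\<^sup>2 / 2) * p v \<partial>lborel)))"

text \<open>
  The posterior, as a law on the coefficient sequence \<open>\<theta>\<close> of \<open>f\<close>, given the data \<open>X\<close>;
  \<open>\<sigma> l\<close> is the scale of the prior at level \<open>l\<close>.
\<close>

definition posterior ::
  "int set \<Rightarrow> (int \<Rightarrow> int set) \<Rightarrow> (int \<Rightarrow> real) \<Rightarrow> (real \<Rightarrow> real) \<Rightarrow> nat
     \<Rightarrow> (int \<times> int \<Rightarrow> real) \<Rightarrow> (int \<times> int \<Rightarrow> real) measure" where
  "posterior L Z \<sigma> \<phi> n X =
     PiM (Sigma L Z) (\<lambda>i. coord_posterior n (prior_density \<phi> (\<sigma> (fst i))) (X i))"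

text \<open>
  The squared distance \<open>\<parallel>f - f\<^sub>0\<parallel>\<^sup>2\<close> for the element \<open>f\<close> of \<open>L\<^sup>2\<close> with coefficient sequence \<open>\<theta>\<close>.
  Such an \<open>f\<close> is unique up to null sets, and it exists iff \<open>\<theta>\<close> is square-summable; the distance is
  set to \<open>\<infinity>\<close> otherwise, so an integral of it can be finite only if almost all \<open>\<theta>\<close> determine an \<open>f\<close>.
\<close>

definition has_coeffs ::
  "'i set \<Rightarrow> ('i \<Rightarrow> real \<Rightarrow> complex) \<Rightarrow> ('i \<Rightarrow> real) \<Rightarrow> (real \<Rightarrow> complex) \<Rightarrow> bool" where
  "has_coeffs I \<psi> \<theta> f \<longleftrightarrow> f \<in> L2 \<and> (\<forall>i\<in>I. L2_inner f (\<psi> i) = complex_of_real (\<theta> i))"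

definition sq_loss ::
  "'i set \<Rightarrow> ('i \<Rightarrow> real \<Rightarrow> complex) \<Rightarrow> (real \<Rightarrow> complex) \<Rightarrow> ('i \<Rightarrow> real) \<Rightarrow> ennreal" where
  "sq_loss I \<psi> f0 \<theta> =
     (if \<exists>f. has_coeffs I \<psi> \<theta> f then L2_sqdist (SOME f. has_coeffs I \<psi> \<theta> f) f0 else \<infinity>)"

definition posterior_risk ::
  "int set \<Rightarrow> (int \<Rightarrow> int set) \<Rightarrow> (int \<times> int \<Rightarrow> real \<Rightarrow> complex) \<Rightarrow> (int \<Rightarrow> real)
     \<Rightarrow> (real \<Rightarrow> real) \<Rightarrow> (real \<Rightarrow> complex) \<Rightarrow> nat \<Rightarrow> ennreal" where
  "posterior_risk L Z \<psi> \<sigma> \<phi> f0 n =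
     (\<integral>\<^sup>+X. (\<integral>\<^sup>+\<theta>. sq_loss (Sigma L Z) \<psi> f0 \<theta> \<partial>posterior L Z \<sigma> \<phi> n X)
        \<partial>data_law (Sigma L Z) \<psi> n f0)"

end

theory Submission
  imports Defs
begin

text \<open>
  By Parseval, Riesz--Fischer and Tonelli, the posterior risk is at most the sum over all \<open>(l, k)\<close> of
  one-dimensional risks. Such a risk is bounded by a constant multiple of \<open>min \<sigma>\<^sub>l\<^sup>2 n\<^sup>-\<^sup>1\<close>.
  For \<open>n \<sigma>\<^sub>l\<^sup>2 \<ge> 1\<close>, the prior density is at most \<open>C / \<sigma>\<^sub>l\<close>, and at least \<open>c / \<sigma>\<^sub>l\<close> at distance
  \<open>O(n\<^sup>-\<^sup>1\<^sup>/\<^sup>2)\<close> from the truth, so the posterior behaves as under a flat prior. For \<open>n \<sigma>\<^sub>l\<^sup>2 \<le> 1\<close>, the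
  normalising constant is bounded below by a multiple of the likelihood of the truth. This cancels
  the density of the data, and averaging over the data leaves the second moment of the prior.

  For the sum, \<open>min v b = \<integral>\<^sub>0\<^sup>b 1{s < v} ds\<close>, and in both types of bases the number of indices with
  \<open>\<sigma>\<^sub>l\<^sup>2 > s\<close> is \<open>O(s powr (- 1 / (2 \<gamma> + 1)))\<close>, which is integrated over \<open>(0, n\<^sup>-\<^sup>1)\<close>.
\<close>

subsection \<open>Square-integrable functions\<close>

text \<open>A real-valued counterpart of \<open>L2_sqdist\<close>, convenient for algebra. The
  Bochner integral of a non-integrable function is 0, so the value is the squared norm only on
  \<open>L2\<close>.\<close>

definition L2_sqnorm :: "(real \<Rightarrow> complex) \<Rightarrow> real" where
  "L2_sqnorm f = (\<integral>t. (norm (f t))\<^sup>2 \<partial>lebesgue_on {0..1})"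

lemma L2_measurable: "f \<in> L2 \<Longrightarrow> f \<in> borel_measurable (lebesgue_on {0..1})"
  and L2_integrable: "f \<in> L2 \<Longrightarrow> integrable (lebesgue_on {0..1}) (\<lambda>t. (norm (f t))\<^sup>2)"
  by (auto simp: L2_def)

lemma L2_sqnorm_nonneg: "0 \<le> L2_sqnorm f"
  by (simp add: L2_sqnorm_def)

lemma L2_zero: "(\<lambda>_. 0) \<in> L2"
  by (simp add: L2_def)

lemma L2I_bound:
  assumes "f \<in> borel_measurable (lebesgue_on {0..1})"
    and "(\<integral>\<^sup>+t. ennreal ((norm (f t))\<^sup>2) \<partial>lebesgue_on {0..1}) < \<infinity>"
  shows "f \<in> L2"
  using assms unfolding L2_def by (auto intro!: integrableI_bounded)

lemma L2_sqdist_eq: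
  assumes "(\<lambda>t. f t - g t) \<in> L2"
  shows "L2_sqdist f g = ennreal (L2_sqnorm (\<lambda>t. f t - g t))"
  unfolding L2_sqdist_def L2_sqnorm_def
  by (rule nn_integral_eq_integral[OF L2_integrable[OF assms]]) simp

lemma L2_mult_integrable:
  assumes "f \<in> L2" "g \<in> L2"
  shows "integrable (lebesgue_on {0..1}) (\<lambda>t. f t * cnj (g t))"
proof (rule Bochner_Integration.integrable_bound)
  show "integrable (lebesgue_on {0..1}) (\<lambda>t. (norm (f t))\<^sup>2 + (norm (g t))\<^sup>2)"
    using assms[THEN L2_integrable] by simp
  note [measurable] = assms[THEN L2_measurable]
  have [measurable]: "cnj \<in> borel_measurable borel"
    by (intro borel_measurable_continuous_onI continuous_intros)
  show "(\<lambda>t. f t * cnj (g t)) \<in> borel_measurable (lebesgue_on {0..1})"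
    by measurable
  have "x * y \<le> x\<^sup>2 + y\<^sup>2" if "x \<ge> 0" "y \<ge> 0" for x y :: real
    using sum_squares_bound[of x y] mult_nonneg_nonneg[OF that] by simp
  then show "AE t in lebesgue_on {0..1}. norm (f t * cnj (g t)) \<le> norm ((norm (f t))\<^sup>2 + (norm (g t))\<^sup>2)"
    by (auto simp: norm_mult)
qed

lemma L2_diff_scale:
  assumes "f \<in> L2" "g \<in> L2"
  shows "(\<lambda>t. f t - a * g t) \<in> L2"
  unfolding L2_def
proof (intro CollectI conjI)
  note [measurable] = assms[THEN L2_measurable]
  show meas: "(\<lambda>t. f t - a * g t) \<in> borel_measurable (lebesgue_on {0..1})"
    by measurable
  show "integrable (lebesgue_on {0..1}) (\<lambda>t. (norm (f t - a * g t))\<^sup>2)"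
  proof (rule Bochner_Integration.integrable_bound)
    show "integrable (lebesgue_on {0..1}) (\<lambda>t. 2 * (norm (f t))\<^sup>2 + 2 * (norm a)\<^sup>2 * (norm (g t))\<^sup>2)"
      using assms[THEN L2_integrable] by simp
    show "(\<lambda>t. (norm (f t - a * g t))\<^sup>2) \<in> borel_measurable (lebesgue_on {0..1})"
      by measurable
    have "(norm (u - v))\<^sup>2 \<le> 2 * (norm u)\<^sup>2 + 2 * (norm v)\<^sup>2" for u v :: complex
    proof -
      have "(norm (u - v))\<^sup>2 \<le> (norm u + norm v)\<^sup>2"
        by (intro power_mono norm_triangle_ineq4) auto
      also have "\<dots> \<le> 2 * (norm u)\<^sup>2 + 2 * (norm v)\<^sup>2"
        using sum_squares_bound[of "norm u" "norm v"] by (simp add: power2_sum)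
      finally show ?thesis .
    qed
    then have "(norm (f t - a * g t))\<^sup>2 \<le> 2 * (norm (f t))\<^sup>2 + 2 * (norm a)\<^sup>2 * (norm (g t))\<^sup>2" for t
      by (metis norm_mult power_mult_distrib mult.assoc)
    then show "AE t in lebesgue_on {0..1}. norm ((norm (f t - a * g t))\<^sup>2)
        \<le> norm (2 * (norm (f t))\<^sup>2 + 2 * (norm a)\<^sup>2 * (norm (g t))\<^sup>2)"
      by auto
  qed
qed

lemma L2_diff: "f \<in> L2 \<Longrightarrow> g \<in> L2 \<Longrightarrow> (\<lambda>t. f t - g t) \<in> L2"
  using L2_diff_scale[of f g 1] by simp

lemma L2_add_scale: "f \<in> L2 \<Longrightarrow> g \<in> L2 \<Longrightarrow> (\<lambda>t. f t + a * g t) \<in> L2"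
  using L2_diff_scale[of f g "- a"] by simp

lemma L2_sum_scale:
  assumes "\<And>i. i \<in> F \<Longrightarrow> \<psi> i \<in> L2"
  shows "(\<lambda>t. \<Sum>i\<in>F. a i * \<psi> i t) \<in> L2"
  using assms
proof (induction F rule: infinite_finite_induct)
  case (insert j F)
  then have "(\<lambda>t. (\<Sum>i\<in>F. a i * \<psi> i t) + a j * \<psi> j t) \<in> L2"
    by (intro L2_add_scale) auto
  then show ?case
    using insert by (simp add: add.commute)
qed (auto simp: L2_zero)

lemma L2_inner_diff_scale:
  assumes "f \<in> L2" "g \<in> L2" "h \<in> L2"
  shows "L2_inner (\<lambda>t. f t - a * g t) h = L2_inner f h - a * L2_inner g h"
  using L2_mult_integrable[OF assms(1,3)] L2_mult_integrable[OF assms(2,3)]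
  by (simp add: L2_inner_def left_diff_distrib mult.assoc)

lemma L2_inner_diff:
  assumes "f \<in> L2" "g \<in> L2" "h \<in> L2"
  shows "L2_inner (\<lambda>t. f t - g t) h = L2_inner f h - L2_inner g h"
  using L2_inner_diff_scale[OF assms, of 1] by simp

lemma L2_inner_add_scale:
  assumes "f \<in> L2" "g \<in> L2" "h \<in> L2"
  shows "L2_inner (\<lambda>t. f t + a * g t) h = L2_inner f h + a * L2_inner g h"
  using L2_inner_diff_scale[OF assms, of "- a"] by simp

lemma L2_inner_self: "L2_inner f f = complex_of_real (L2_sqnorm f)"
  unfolding L2_inner_def L2_sqnorm_def
  by (simp only: complex_norm_square[symmetric] of_real_power[symmetric] integral_complex_of_real)

text \<open>The pointwise expansion of \<open>(norm (u - a * v))\<^sup>2\<close> is integrated.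
  Bessel's inequality for one vector, Pythagoras and best approximation all come from this identity
  with different choices of \<open>a\<close>.\<close>

lemma L2_sqnorm_diff_scale:
  assumes "f \<in> L2" "g \<in> L2"
  shows "L2_sqnorm (\<lambda>t. f t - a * g t)
    = L2_sqnorm f - 2 * Re (cnj a * L2_inner f g) + (norm a)\<^sup>2 * L2_sqnorm g"
proof -
  have *: "(norm (u - a * v))\<^sup>2 = (norm u)\<^sup>2 - 2 * Re (cnj a * (u * cnj v)) + (norm a)\<^sup>2 * (norm v)\<^sup>2"
    for u v :: complex
    by (simp add: cmod_power2 power_mult_distrib) (simp add: power2_eq_square algebra_simps)
  have i: "integrable (lebesgue_on {0..1}) (\<lambda>t. cnj a * (f t * cnj (g t)))"
    using L2_mult_integrable[OF assms] by simp
  have "Re (cnj a * L2_inner f g) = (\<integral>t. Re (cnj a * (f t * cnj (g t))) \<partial>lebesgue_on {0..1})"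
    unfolding L2_inner_def using i by (subst integral_Re) simp_all
  then show ?thesis
    unfolding L2_sqnorm_def * using assms[THEN L2_integrable] integrable_Re[OF i]
    by (simp del: times_complex.sel)
qed

text \<open>Bessel's inequality for one unit vector: the residual of the projection onto
  \<open>g\<close> has nonnegative squared norm.\<close>

lemma norm_L2_inner_le:
  assumes "f \<in> L2" "g \<in> L2" "L2_sqnorm g = 1"
  shows "(norm (L2_inner f g))\<^sup>2 \<le> L2_sqnorm f"
proof -
  have "0 \<le> L2_sqnorm (\<lambda>t. f t - L2_inner f g * g t)"
    by (rule L2_sqnorm_nonneg)
  also have "\<dots> = L2_sqnorm f - (norm (L2_inner f g))\<^sup>2"
    unfolding L2_sqnorm_diff_scale[OF assms(1,2)] assms(3) cmod_power2
    by (simp add: power2_eq_square)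
  finally show ?thesis by simp
qed

subsection \<open>Orthonormal bases\<close>

lemma orthonormal_basisD:
  assumes "orthonormal_basis I \<psi>" "i \<in> I"
  shows "\<psi> i \<in> L2" "L2_sqnorm (\<psi> i) = 1"
    and "j \<in> I \<Longrightarrow> i \<noteq> j \<Longrightarrow> L2_inner (\<psi> i) (\<psi> j) = 0"
proof -
  show "\<psi> i \<in> L2" "j \<in> I \<Longrightarrow> i \<noteq> j \<Longrightarrow> L2_inner (\<psi> i) (\<psi> j) = 0"
    using assms by (auto simp: orthonormal_basis_def)
  have "L2_inner (\<psi> i) (\<psi> i) = 1"
    using assms by (auto simp: orthonormal_basis_def)
  then show "L2_sqnorm (\<psi> i) = 1"
    unfolding L2_inner_self by simp
qed

lemma L2_inner_orthonormal_sum: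
  assumes "orthonormal_basis I \<psi>" "finite F" "F \<subseteq> I" "j \<in> I"
  shows "L2_inner (\<lambda>t. \<Sum>i\<in>F. a i * \<psi> i t) (\<psi> j) = (if j \<in> F then a j else 0)"
  using assms(2,3)
proof (induction F)
  case empty
  show ?case by (simp add: L2_inner_def)
next
  case (insert k F)
  have "L2_inner (\<lambda>t. \<Sum>i\<in>insert k F. a i * \<psi> i t) (\<psi> j)
      = L2_inner (\<lambda>t. (\<Sum>i\<in>F. a i * \<psi> i t) + a k * \<psi> k t) (\<psi> j)"
    using insert by (simp add: add.commute)
  also have "\<dots> = L2_inner (\<lambda>t. \<Sum>i\<in>F. a i * \<psi> i t) (\<psi> j) + a k * L2_inner (\<psi> k) (\<psi> j)"
    using insert orthonormal_basisD(1)[OF assms(1)] assms(4)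
    by (intro L2_inner_add_scale L2_sum_scale) auto
  also have "L2_inner (\<psi> k) (\<psi> j) = (if k = j then 1 else 0)"
    using assms insert by (auto simp: orthonormal_basis_def)
  finally show ?case
    using insert by auto
qed

lemma L2_sqnorm_orthonormal_sum:
  assumes "orthonormal_basis I \<psi>" "finite F" "F \<subseteq> I"
  shows "L2_sqnorm (\<lambda>t. \<Sum>i\<in>F. a i * \<psi> i t) = (\<Sum>i\<in>F. (norm (a i))\<^sup>2)"
  using assms(2,3)
proof (induction F)
  case empty
  show ?case by (simp add: L2_sqnorm_def)
next
  case (insert k F)
  \<comment> \<open>Written as a subtraction, the last term fits the expansion of the squared norm.
    The cross term vanishes because \<open>k\<close> is not in \<open>F\<close>.\<close>
  have "L2_sqnorm (\<lambda>t. \<Sum>i\<in>insert k F. a i * \<psi> i t)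
      = L2_sqnorm (\<lambda>t. (\<Sum>i\<in>F. a i * \<psi> i t) - (- a k) * \<psi> k t)"
    using insert by (simp add: add.commute)
  also have "\<dots> = L2_sqnorm (\<lambda>t. \<Sum>i\<in>F. a i * \<psi> i t) + (norm (a k))\<^sup>2"
    using insert L2_inner_orthonormal_sum[OF assms(1), of F k a] orthonormal_basisD[OF assms(1)]
    by (subst L2_sqnorm_diff_scale) (auto intro!: L2_sum_scale)
  finally show ?case
    using insert by simp
qed

text \<open>Subtracting \<open>a k * \<psi> k\<close> leaves the other coefficients of
  \<open>h\<close> unchanged, hence the induction over arbitrary \<open>h\<close>. Its effect on the
  squared norm is \<open>- (norm (L2_inner h (\<psi> k)))\<^sup>2\<close> plus a completed square,
  which is nonnegative. The basis property supplies approximations with unknown coefficients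
  \<open>a\<close>; here they enter only through the approximation error.\<close>

lemma best_approximation:
  assumes "orthonormal_basis I \<psi>" "finite F" "F \<subseteq> I" "h \<in> L2"
  shows "L2_sqnorm h
    \<le> (\<Sum>i\<in>F. (norm (L2_inner h (\<psi> i)))\<^sup>2) + L2_sqnorm (\<lambda>t. h t - (\<Sum>i\<in>F. a i * \<psi> i t))"
  using assms(2,3,4)
proof (induction F arbitrary: h)
  case (insert k F)
  note \<psi> = orthonormal_basisD[OF assms(1)]
  let ?h = "\<lambda>t. h t - a k * \<psi> k t"
  have h: "?h \<in> L2"
    using insert.prems \<psi>(1) by (intro L2_diff_scale) auto
  have "L2_inner ?h (\<psi> i) = L2_inner h (\<psi> i)" if "i \<in> F" for i
  proof -
    have "k \<in> I" "i \<in> I" "k \<noteq> i"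
      using insert that by auto
    then show ?thesis
      using insert.prems \<psi>(1) by (simp add: L2_inner_diff_scale \<psi>(3))
  qed
  moreover have "(\<lambda>t. ?h t - (\<Sum>i\<in>F. a i * \<psi> i t)) = (\<lambda>t. h t - (\<Sum>i\<in>insert k F. a i * \<psi> i t))"
    using insert.hyps by (simp add: diff_diff_eq)
  ultimately have 1: "L2_sqnorm ?h \<le> (\<Sum>i\<in>F. (norm (L2_inner h (\<psi> i)))\<^sup>2)
      + L2_sqnorm (\<lambda>t. h t - (\<Sum>i\<in>insert k F. a i * \<psi> i t))"
    using insert.IH[OF _ h] insert.prems by simp
  have "L2_sqnorm ?h = L2_sqnorm h - 2 * Re (cnj (a k) * L2_inner h (\<psi> k)) + (norm (a k))\<^sup>2"
    using insert.prems \<psi>(1,2)[of k] by (simp add: L2_sqnorm_diff_scale)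
  also have "\<dots> = L2_sqnorm h - (norm (L2_inner h (\<psi> k)))\<^sup>2 + (norm (a k - L2_inner h (\<psi> k)))\<^sup>2"
    unfolding cmod_power2 by (simp add: power2_eq_square algebra_simps)
  finally show ?case
    using 1 zero_le_power2[of "norm (a k - L2_inner h (\<psi> k))"]
    unfolding sum.insert[OF insert.hyps] by linarith
qed simp

text \<open>The half of Parseval's identity that expresses completeness: a finite linear combination
  within \<open>e\<close> of \<open>h\<close> bounds the squared norm by finitely many squared
  coefficients plus \<open>e\<close>.\<close>

lemma L2_sqnorm_le_coeffs:
  assumes "orthonormal_basis I \<psi>" "h \<in> L2"
  shows "ennreal (L2_sqnorm h) \<le> (\<integral>\<^sup>+i. ennreal ((norm (L2_inner h (\<psi> i)))\<^sup>2) \<partial>count_space I)"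
    (is "_ \<le> ?q")
proof (rule ennreal_le_epsilon)
  fix e :: real
  assume "0 < e"
  with assms obtain F a where F: "finite F" "F \<subseteq> I"
    and "L2_sqdist h (\<lambda>t. \<Sum>i\<in>F. a i * \<psi> i t) < ennreal e"
    unfolding orthonormal_basis_def by blast
  moreover have "(\<lambda>t. h t - (\<Sum>i\<in>F. a i * \<psi> i t)) \<in> L2"
    using F orthonormal_basisD(1)[OF assms(1)] by (intro L2_diff assms L2_sum_scale) auto
  ultimately have "L2_sqnorm (\<lambda>t. h t - (\<Sum>i\<in>F. a i * \<psi> i t)) < e"
    by (auto simp: L2_sqdist_eq ennreal_less_iff L2_sqnorm_nonneg)
  then have "L2_sqnorm h \<le> (\<Sum>i\<in>F. (norm (L2_inner h (\<psi> i)))\<^sup>2) + e"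
    using best_approximation[OF assms(1) F assms(2), of a] by simp
  then have "ennreal (L2_sqnorm h) \<le> ennreal (\<Sum>i\<in>F. (norm (L2_inner h (\<psi> i)))\<^sup>2) + ennreal e"
    using \<open>0 < e\<close> by (simp add: sum_nonneg flip: ennreal_plus)
  also have "ennreal (\<Sum>i\<in>F. (norm (L2_inner h (\<psi> i)))\<^sup>2)
      = (\<integral>\<^sup>+i. ennreal ((norm (L2_inner h (\<psi> i)))\<^sup>2) \<partial>count_space F)"
    using F by (simp add: nn_integral_count_space_finite)
  also have "\<dots> \<le> ?q"
    using F(2)
    by (auto simp: nn_integral_count_space_indicator intro!: nn_integral_mono split: split_indicator)
  finally show "ennreal (L2_sqnorm h) \<le> ?q + ennreal e"
    by (simp add: add_right_mono)
qed

section \<open>The Riesz--Fischer theorem and the loss in terms of coefficients\<close>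

lemma finite_measure_unit_interval: "finite_measure (lebesgue_on {0..1::real})"
  by (rule finite_measureI) (simp add: emeasure_restrict_space)

text \<open>The partial sums along an enumeration of \<open>I\<close> are Cauchy in mean square. A
  subsequence with geometrically small increments converges almost everywhere, Fatou's lemma bounds
  the distance of its limit from every partial sum, and Bessel's inequality carries the coefficients
  over to the limit.\<close>

lemma Riesz_Fischer:
  fixes d :: "'i \<Rightarrow> complex"
  assumes basis: "orthonormal_basis I \<psi>" and I: "countable I"
    and d: "(\<integral>\<^sup>+i. ennreal ((norm (d i))\<^sup>2) \<partial>count_space I) < \<infinity>"
  obtains h where "h \<in> L2" "\<And>i. i \<in> I \<Longrightarrow> L2_inner h (\<psi> i) = d i"
proof -
  interpret finite_measure "lebesgue_on {0..1::real}"
    by (rule finite_measure_unit_interval)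
  note \<psi> = orthonormal_basisD[OF basis]
  define F where "F n = {i \<in> I. to_nat_on I i < n}" for n
  define s where "s n t = (\<Sum>i\<in>F n. d i * \<psi> i t)" for n t
  define q where "q n = (\<Sum>i\<in>F n. (norm (d i))\<^sup>2)" for n
  have F: "finite (F n)" "F n \<subseteq> I" for n
  proof -
    have "inj_on (to_nat_on I) (F n)"
      using inj_on_to_nat_on[OF I] by (rule inj_on_subset) (auto simp: F_def)
    moreover have "to_nat_on I ` F n \<subseteq> {..<n}"
      by (auto simp: F_def)
    ultimately show "finite (F n)"
      using finite_subset finite_imageD by blast
  qed (auto simp: F_def)
  have F_mono: "F m \<subseteq> F n" if "m \<le> n" for m n
    using that by (auto simp: F_def)
  have s: "s n \<in> L2" for n
    unfolding s_def[abs_def] using F \<psi>(1) by (intro L2_sum_scale) auto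
  have norm_diff: "L2_sqnorm (\<lambda>t. s n t - s m t) = q n - q m" if "m \<le> n" for m n
  proof -
    have "(\<lambda>t. s n t - s m t) = (\<lambda>t. \<Sum>i\<in>F n - F m. d i * \<psi> i t)"
      unfolding s_def using F F_mono[OF that] by (simp add: sum_diff)
    moreover have "q n - q m = (\<Sum>i\<in>F n - F m. (norm (d i))\<^sup>2)"
      unfolding q_def using F F_mono[OF that] by (simp add: sum_diff)
    ultimately show ?thesis
      using F L2_sqnorm_orthonormal_sum[OF basis, of "F n - F m" d] by auto
  qed
  have "incseq q"
    unfolding q_def by (intro incseq_SucI sum_mono2 F F_mono) auto
  moreover have "q n \<le> enn2real (\<integral>\<^sup>+i. ennreal ((norm (d i))\<^sup>2) \<partial>count_space I)" for n
  proof -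
    have "ennreal (q n) = (\<integral>\<^sup>+i. ennreal ((norm (d i))\<^sup>2) \<partial>count_space (F n))"
      unfolding q_def using F by (simp add: nn_integral_count_space_finite)
    also have "\<dots> \<le> (\<integral>\<^sup>+i. ennreal ((norm (d i))\<^sup>2) \<partial>count_space I)"
      using F(2)[of n]
      by (auto simp: nn_integral_count_space_indicator intro!: nn_integral_mono split: split_indicator)
    finally show ?thesis
      using d enn2real_mono[of "ennreal (q n)"] by (simp add: q_def sum_nonneg)
  qed
  ultimately obtain l where l: "q \<longlonglongrightarrow> l" and q_le: "\<And>n. q n \<le> l"
    using incseq_convergent[of q] by metis
  \<comment> \<open>The rate \<open>(1 / 4) ^ k\<close> for squared norms is the summable rate
    \<open>(1 / 2) ^ k\<close> for norms.\<close>
  have "\<exists>N. \<forall>m\<ge>N. \<forall>n\<ge>N. norm (q m - q n) < (1 / 4) ^ k" for k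
    using CauchyD[OF LIMSEQ_imp_Cauchy[OF l], of "(1 / 4) ^ k"] by simp
  then obtain N where N: "\<And>k m n. m \<ge> N k \<Longrightarrow> n \<ge> N k \<Longrightarrow> norm (q m - q n) < (1 / 4) ^ k"
    by metis
  \<comment> \<open>Cumulative sums of \<open>Suc (N j)\<close> make \<open>r\<close> increasing and
    keep it above both \<open>k\<close> and \<open>N k\<close>.\<close>
  define r where "r k = (\<Sum>j\<le>k. Suc (N j))" for k
  have r_ge: "k \<le> r k" "N k \<le> r k" "r k \<le> r (Suc k)" for k
    unfolding r_def by (induction k) auto
  define g where "g k t = s (r (Suc k)) t - s (r k) t" for k t
  have g: "g k \<in> L2" for k
    unfolding g_def[abs_def] by (intro L2_diff s)
  have g_norm: "L2_sqnorm (g k) \<le> (1 / 4) ^ k" for k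
    using N[of k "r (Suc k)" "r k"] norm_diff[OF r_ge(3)[of k]] r_ge(2,3)[of k]
    unfolding g_def[abs_def] by (simp add: abs_less_iff)
  have g_int: "(\<integral>\<^sup>+t. ennreal (norm (g k t)) \<partial>lebesgue_on {0..1}) \<le> ennreal ((1 / 2) ^ k)" for k
  proof -
    \<comment> \<open>The inequality of arithmetic and geometric means, in place of Cauchy--Schwarz,
      bounds the integral of the norm by that of its square. With the weight \<open>2 ^ k\<close>
      both resulting terms have order \<open>(1 / 2) ^ k\<close>.\<close>
    have "x \<le> ((1 / 2) ^ k + 2 ^ k * x\<^sup>2) / 2" for x :: real
    proof -
      have "0 \<le> 2 ^ k * (x - (1 / 2) ^ k)\<^sup>2"
        by simp
      also have "\<dots> = 2 ^ k * x\<^sup>2 - 2 * x * (2 ^ k * (1 / 2) ^ k) + (1 / 2) ^ k * (2 ^ k * (1 / 2) ^ k)"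
        by (simp add: power2_eq_square algebra_simps)
      also have "2 ^ k * (1 / 2) ^ k = (1 :: real)"
        by (simp add: power_one_over)
      finally show ?thesis by simp
    qed
    then have "(\<integral>\<^sup>+t. ennreal (norm (g k t)) \<partial>lebesgue_on {0..1})
        \<le> (\<integral>\<^sup>+t. ennreal (((1 / 2) ^ k + 2 ^ k * (norm (g k t))\<^sup>2) / 2) \<partial>lebesgue_on {0..1})"
      by (intro nn_integral_mono ennreal_leI)
    also have "\<dots> = ennreal (\<integral>t. ((1 / 2) ^ k + 2 ^ k * (norm (g k t))\<^sup>2) / 2 \<partial>lebesgue_on {0..1})"
      using L2_integrable[OF g, of k] by (intro nn_integral_eq_integral) auto
    also have "(\<integral>t. ((1 / 2) ^ k + 2 ^ k * (norm (g k t))\<^sup>2) / 2 \<partial>lebesgue_on {0..1})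
        = ((1 / 2) ^ k + 2 ^ k * L2_sqnorm (g k)) / 2"
      using L2_integrable[OF g, of k]
      by (simp add: L2_sqnorm_def measure_restrict_space)
    also have "ennreal \<dots> \<le> ennreal (((1 / 2) ^ k + 2 ^ k * (1 / 4) ^ k) / 2)"
      using g_norm[of k] by (intro ennreal_leI divide_right_mono add_left_mono mult_left_mono) auto
    also have "((1 / 2) ^ k + 2 ^ k * (1 / 4) ^ k) / 2 = ((1 / 2) ^ k :: real)"
      by (simp flip: power_mult_distrib)
    finally show ?thesis .
  qed
  have [measurable]: "s n \<in> borel_measurable (lebesgue_on {0..1})"
    "g n \<in> borel_measurable (lebesgue_on {0..1})" for n
    using s g by (auto dest: L2_measurable)
  have "AE t in lebesgue_on {0..1}. (\<Sum>k. ennreal (norm (g k t))) \<noteq> \<infinity>"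
  proof (rule nn_integral_noteq_infinite)
    have "(\<integral>\<^sup>+t. (\<Sum>k. ennreal (norm (g k t))) \<partial>lebesgue_on {0..1})
        = (\<Sum>k. \<integral>\<^sup>+t. ennreal (norm (g k t)) \<partial>lebesgue_on {0..1})"
      by (intro nn_integral_suminf) measurable
    also have "\<dots> \<le> (\<Sum>k. ennreal ((1 / 2) ^ k))"
      by (intro suminf_le g_int) auto
    also have "\<dots> = ennreal (\<Sum>k. (1 / 2) ^ k)"
      by (intro suminf_ennreal2) auto
    also have "\<dots> < \<infinity>" by simp
    finally show "(\<integral>\<^sup>+t. (\<Sum>k. ennreal (norm (g k t))) \<partial>lebesgue_on {0..1}) \<noteq> \<infinity>"
      by simp
  qed measurable
  then have AE_lim: "AE t in lebesgue_on {0..1}. (\<lambda>k. s (r k) t) \<longlonglongrightarrow> lim (\<lambda>k. s (r k) t)"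
  proof eventually_elim
    case (elim t)
    have "summable (\<lambda>k. norm (g k t))"
      using elim by (intro summable_suminf_not_top) auto
    then have "summable (\<lambda>k. g k t)"
      by (rule summable_norm_cancel)
    moreover have "(\<Sum>j<k. g j t) = s (r k) t - s (r 0) t" for k
      unfolding g_def by (rule sum_lessThan_telescope)
    ultimately have "(\<lambda>k. s (r k) t - s (r 0) t + s (r 0) t) \<longlonglongrightarrow> (\<Sum>k. g k t) + s (r 0) t"
      by (intro tendsto_add tendsto_const) (metis (no_types, lifting) ext summable_LIMSEQ)
    then have "convergent (\<lambda>k. s (r k) t)"
      by (auto simp: convergent_def)
    then show ?case
      by (simp add: convergent_LIMSEQ_iff)
  qed
  define h where "h t = lim (\<lambda>k. s (r k) t)" for t
  have [measurable]: "h \<in> borel_measurable (lebesgue_on {0..1})"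
    unfolding h_def[abs_def] by measurable
  \<comment> \<open>Once \<open>r k \<ge> m\<close>, the squared distance of \<open>s (r k)\<close>
    from \<open>s m\<close> is \<open>q (r k) - q m\<close>, which is at most
    \<open>l - q m\<close>.\<close>
  have Fatou: "(\<integral>\<^sup>+t. ennreal ((norm (h t - s m t))\<^sup>2) \<partial>lebesgue_on {0..1}) \<le> ennreal (l - q m)" for m
  proof -
    have "(\<integral>\<^sup>+t. ennreal ((norm (h t - s m t))\<^sup>2) \<partial>lebesgue_on {0..1})
        = (\<integral>\<^sup>+t. liminf (\<lambda>k. ennreal ((norm (s (r k) t - s m t))\<^sup>2)) \<partial>lebesgue_on {0..1})"
    proof (rule nn_integral_cong_AE)
      show "AE t in lebesgue_on {0..1}. ennreal ((norm (h t - s m t))\<^sup>2)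
          = liminf (\<lambda>k. ennreal ((norm (s (r k) t - s m t))\<^sup>2))"
        using AE_lim
      proof eventually_elim
        case (elim t)
        then have "(\<lambda>k. ennreal ((norm (s (r k) t - s m t))\<^sup>2)) \<longlonglongrightarrow> ennreal ((norm (h t - s m t))\<^sup>2)"
          unfolding h_def by (intro tendsto_intros)
        then show ?case
          by (rule lim_imp_Liminf[OF sequentially_bot, symmetric])
      qed
    qed
    also have "\<dots> \<le> liminf (\<lambda>k. \<integral>\<^sup>+t. ennreal ((norm (s (r k) t - s m t))\<^sup>2) \<partial>lebesgue_on {0..1})"
      by (intro nn_integral_liminf) measurable
    also have "\<dots> \<le> limsup (\<lambda>k. \<integral>\<^sup>+t. ennreal ((norm (s (r k) t - s m t))\<^sup>2) \<partial>lebesgue_on {0..1})"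
      by (intro Liminf_le_Limsup) auto
    also have "\<dots> \<le> ennreal (l - q m)"
    proof (rule Limsup_bounded)
      show "\<forall>\<^sub>F k in sequentially.
          (\<integral>\<^sup>+t. ennreal ((norm (s (r k) t - s m t))\<^sup>2) \<partial>lebesgue_on {0..1}) \<le> ennreal (l - q m)"
        using eventually_ge_at_top[of m]
      proof eventually_elim
        case (elim k)
        then have "m \<le> r k"
          using r_ge(1)[of k] by simp
        then show ?case
          using L2_sqdist_eq[OF L2_diff[OF s[of "r k"] s[of m]]] norm_diff[of m "r k"] q_le[of "r k"]
          by (auto simp: L2_sqdist_def intro!: ennreal_leI)
      qed
    qed
    finally show ?thesis .
  qed
  have hs: "(\<lambda>t. h t - s m t) \<in> L2" for m
    using le_less_trans[OF Fatou[of m]] by (intro L2I_bound) auto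
  then have h: "h \<in> L2"
    using L2_add_scale[OF hs s, of 0 1 0] by simp
  have hs_norm: "L2_sqnorm (\<lambda>t. h t - s m t) \<le> l - q m" for m
    using Fatou[of m] q_le[of m] unfolding L2_sqdist_eq[OF hs, unfolded L2_sqdist_def]
    by (simp add: ennreal_le_iff)
  have "L2_inner h (\<psi> j) = d j" if j: "j \<in> I" for j
  proof -
    \<comment> \<open>For such \<open>m\<close> the index \<open>j\<close> belongs to
      \<open>F m\<close>, so the coefficient of \<open>s m\<close> at \<open>j\<close> is already
      \<open>d j\<close>. The bound \<open>l - q m\<close> tends to 0.\<close>
    have "(norm (L2_inner h (\<psi> j) - d j))\<^sup>2 \<le> l - q m" if "m > to_nat_on I j" for m
    proof -
      have "L2_inner (\<lambda>t. h t - s m t) (\<psi> j) = L2_inner h (\<psi> j) - d j"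
        using L2_inner_diff[OF h s \<psi>(1)[OF j], of m]
          L2_inner_orthonormal_sum[OF basis F(1)[of m] F(2)[of m] j, of d, folded s_def] j that
        by (simp add: F_def)
      then show ?thesis
        using norm_L2_inner_le[OF hs \<psi>(1,2)[OF j], of m] hs_norm[of m] by simp
    qed
    then have "\<exists>n. \<forall>m\<ge>n. (norm (L2_inner h (\<psi> j) - d j))\<^sup>2 \<le> l - q m"
      by (metis Suc_le_eq)
    then have "(norm (L2_inner h (\<psi> j) - d j))\<^sup>2 \<le> l - l"
      by (intro LIMSEQ_le_const[OF tendsto_diff[OF tendsto_const l]])
    then show ?thesis by simp
  qed
  with h that show thesis by blast
qed

text \<open>An infinite sum leaves nothing to show. Otherwise Riesz--Fischer applies to the
  differences \<open>\<theta> i - a i\<close>; adding \<open>f0\<close> gives a function with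
  coefficients \<open>\<theta>\<close>, so the loss is not the default value \<infinity>. The
  function picked by \<open>SOME\<close> may be a different one, but only its coefficients enter the
  bound.\<close>

lemma sq_loss_le_coeffs:
  assumes basis: "orthonormal_basis I \<psi>" and I: "countable I" and f0: "f0 \<in> L2"
    and a: "\<And>i. i \<in> I \<Longrightarrow> L2_inner f0 (\<psi> i) = complex_of_real (a i)"
  shows "sq_loss I \<psi> f0 \<theta> \<le> (\<integral>\<^sup>+i. ennreal ((\<theta> i - a i)\<^sup>2) \<partial>count_space I)"
proof (cases "(\<integral>\<^sup>+i. ennreal ((\<theta> i - a i)\<^sup>2) \<partial>count_space I) < \<infinity>")
  case True
  note \<psi> = orthonormal_basisD[OF basis]
  have "(\<integral>\<^sup>+i. ennreal ((norm (complex_of_real (\<theta> i - a i)))\<^sup>2) \<partial>count_space I) < \<infinity>"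
    using True by (simp only: norm_of_real power2_abs)
  from Riesz_Fischer[OF basis I this] obtain h
    where h: "h \<in> L2" "\<And>i. i \<in> I \<Longrightarrow> L2_inner h (\<psi> i) = complex_of_real (\<theta> i - a i)"
    by blast
  have "has_coeffs I \<psi> \<theta> (\<lambda>t. h t + 1 * f0 t)"
    unfolding has_coeffs_def using h a f0 \<psi>(1)
    by (auto simp only: L2_inner_add_scale intro!: L2_add_scale) simp
  then have ex: "\<exists>f. has_coeffs I \<psi> \<theta> f"
    by blast
  define f where "f = (SOME f. has_coeffs I \<psi> \<theta> f)"
  have f: "f \<in> L2" "\<And>i. i \<in> I \<Longrightarrow> L2_inner f (\<psi> i) = complex_of_real (\<theta> i)"
    using someI_ex[OF ex] by (auto simp: f_def has_coeffs_def)
  have "L2_inner (\<lambda>t. f t - f0 t) (\<psi> i) = complex_of_real (\<theta> i - a i)" if "i \<in> I" for i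
    using L2_inner_diff[OF f(1) f0 \<psi>(1)[OF that]] f(2) a that by simp
  then have "(norm (L2_inner (\<lambda>t. f t - f0 t) (\<psi> i)))\<^sup>2 = (\<theta> i - a i)\<^sup>2" if "i \<in> I" for i
    using that by (simp only: norm_of_real power2_abs)
  then have "(\<integral>\<^sup>+i. ennreal ((norm (L2_inner (\<lambda>t. f t - f0 t) (\<psi> i)))\<^sup>2) \<partial>count_space I)
      = (\<integral>\<^sup>+i. ennreal ((\<theta> i - a i)\<^sup>2) \<partial>count_space I)"
    by (intro nn_integral_cong) simp
  then show ?thesis
    using L2_sqnorm_le_coeffs[OF basis L2_diff[OF f(1) f0]] ex
    by (simp add: sq_loss_def L2_sqdist_eq[OF L2_diff[OF f(1) f0]] flip: f_def)
next
  case False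
  then show ?thesis
    by (simp add: less_top[symmetric])
qed

subsection \<open>Summation of the coordinatewise bounds\<close>

lemma min_eq_nn_integral:
  assumes "0 \<le> (a::real)" "0 \<le> b"
  shows "ennreal (min a b) = (\<integral>\<^sup>+s. indicator {0<..<b} s * indicator {..<a} s \<partial>lborel)"
proof -
  have "(\<integral>\<^sup>+s. indicator {0<..<b} s * indicator {..<a} s \<partial>lborel) = (\<integral>\<^sup>+s. indicator {0<..<min a b} s \<partial>lborel)"
    by (intro nn_integral_cong) (auto split: split_indicator)
  then show ?thesis
    using assms by simp
qed

lemma nn_integral_powr_from_0:
  fixes b p :: real
  assumes "0 \<le> b" "- 1 < p"
  shows "(\<integral>\<^sup>+s. ennreal (s powr p) * indicator {0<..<b} s \<partial>lborel) \<le> ennreal (b powr (p + 1) / (p + 1))"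
proof -
  have "((\<lambda>s. if s \<in> {0..b} then s powr p else 0) has_integral (b powr (p + 1) / (p + 1))) UNIV"
    using has_integral_powr_from_0[of p b] assms by (simp only: has_integral_restrict_UNIV)
  then have "(\<integral>\<^sup>+s. ennreal (if s \<in> {0..b} then s powr p else 0) \<partial>lborel) = ennreal (b powr (p + 1) / (p + 1))"
    by (intro nn_integral_has_integral_lborel) auto
  moreover have "(\<integral>\<^sup>+s. ennreal (s powr p) * indicator {0<..<b} s \<partial>lborel)
      \<le> (\<integral>\<^sup>+s. ennreal (if s \<in> {0..b} then s powr p else 0) \<partial>lborel)"
    by (intro nn_integral_mono) (auto split: split_indicator)
  ultimately show ?thesis by simp
qed

text \<open>Tonelli exchanges the sum with the layer-cake integral of the minimum. The inner sum
  then counts the indices with \<open>v i > s\<close>, and the bound on this count is integrable at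
  0 because \<open>p > - 1\<close>.\<close>

lemma sum_min_le_of_count_le:
  fixes v :: "'i \<Rightarrow> real" and B b p :: real
  assumes I: "countable I" and v: "\<And>i. i \<in> I \<Longrightarrow> 0 \<le> v i" and "0 \<le> b" "- 1 < p" "0 \<le> B"
    and count: "\<And>s. 0 < s \<Longrightarrow> s < b \<Longrightarrow>
      (\<integral>\<^sup>+i. indicator {..<v i} s \<partial>count_space I) \<le> ennreal (B * s powr p)"
  shows "(\<integral>\<^sup>+i. ennreal (min (v i) b) \<partial>count_space I) \<le> ennreal (B * (b powr (p + 1) / (p + 1)))"
proof -
  have "(\<integral>\<^sup>+i. ennreal (min (v i) b) \<partial>count_space I)
      = (\<integral>\<^sup>+i. (\<integral>\<^sup>+s. indicator {0<..<b} s * indicator {..<v i} s \<partial>lborel) \<partial>count_space I)"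
    using v \<open>0 \<le> b\<close> by (intro nn_integral_cong min_eq_nn_integral) auto
  also have "\<dots> = (\<integral>\<^sup>+s. (\<integral>\<^sup>+i. indicator {0<..<b} s * indicator {..<v i} s \<partial>count_space I) \<partial>lborel)"
    by (intro nn_integral_count_space_nn_integral[symmetric] I) measurable
  also have "\<dots> \<le> (\<integral>\<^sup>+s. ennreal B * (ennreal (s powr p) * indicator {0<..<b} s) \<partial>lborel)"
    using count \<open>0 \<le> B\<close>
    by (intro nn_integral_mono) (auto split: split_indicator simp: ennreal_mult'[symmetric])
  also have "\<dots> = ennreal B * (\<integral>\<^sup>+s. ennreal (s powr p) * indicator {0<..<b} s \<partial>lborel)"
    by (intro nn_integral_cmult) measurable
  also have "\<dots> \<le> ennreal B * ennreal (b powr (p + 1) / (p + 1))"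
    using assms by (intro mult_left_mono nn_integral_powr_from_0) auto
  also have "\<dots> = ennreal (B * (b powr (p + 1) / (p + 1)))"
    using \<open>0 \<le> B\<close> by (rule ennreal_mult'[symmetric])
  finally show ?thesis .
qed

section \<open>Counting the indices whose squared prior scale exceeds a threshold\<close>

lemma nn_integral_count_space_Sigma_fst:
  fixes g :: "'a \<Rightarrow> ennreal"
  shows "(\<integral>\<^sup>+i. g (fst i) \<partial>count_space (Sigma L Z)) = (\<integral>\<^sup>+l. g l * emeasure (count_space UNIV) (Z l) \<partial>count_space L)"
proof -
  have "(\<integral>\<^sup>+i. g (fst i) \<partial>count_space (Sigma L Z))
      = (\<integral>\<^sup>+i. g (fst i) * indicator (Sigma L Z) i \<partial>count_space UNIV)"
    by (rule nn_integral_count_space_indicator) simp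
  also have "\<dots> = (\<integral>\<^sup>+l. (\<integral>\<^sup>+k. g l * indicator L l * indicator (Z l) k \<partial>count_space UNIV) \<partial>count_space UNIV)"
    by (subst nn_integral_fst_count_space[symmetric])
       (auto intro!: nn_integral_cong split: split_indicator)
  also have "\<dots> = (\<integral>\<^sup>+l. g l * emeasure (count_space UNIV) (Z l) * indicator L l \<partial>count_space UNIV)"
    by (intro nn_integral_cong) (simp add: nn_integral_cmult mult_ac)
  also have "\<dots> = (\<integral>\<^sup>+l. g l * emeasure (count_space UNIV) (Z l) \<partial>count_space L)"
    by (rule nn_integral_count_space_indicator[symmetric]) simp
  finally show ?thesis .
qed

lemma card_int_abs_le:
  assumes "0 \<le> (y::real)"
  shows "finite {l::int. \<bar>of_int l\<bar> \<le> y}" "real (card {l::int. \<bar>of_int l\<bar> \<le> y}) \<le> 2 * y + 1"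
proof -
  have *: "{l::int. \<bar>of_int l\<bar> \<le> y} = {- \<lfloor>y\<rfloor>..\<lfloor>y\<rfloor>}"
    by (auto simp: le_floor_iff abs_le_iff minus_le_iff)
  show "finite {l::int. \<bar>of_int l\<bar> \<le> y}"
    unfolding * by simp
  show "real (card {l::int. \<bar>of_int l\<bar> \<le> y}) \<le> 2 * y + 1"
    unfolding * using assms by simp
qed

text \<open>For \<open>l \<noteq> 0\<close> the squared scale is
  \<open>\<bar>l\<bar> powr (- (2 * \<gamma> + 1))\<close>, which exceeds \<open>s\<close> only if
  \<open>\<bar>l\<bar> \<le> y\<close>, with \<open>y\<close> the power of \<open>s\<close> on the
  right-hand side. At most \<open>2 * y + 1\<close> integers satisfy this, hence at most
  \<open>3 * y\<close>, since \<open>s < 1\<close> gives \<open>y \<ge> 1\<close>.\<close>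

lemma count_prior_scale_Type_A:
  fixes \<gamma> s :: real
  assumes \<gamma>: "0 < \<gamma>" and s: "0 < s" "s < 1" and Z: "\<forall>l\<in>L. card (Z l) = 1"
  shows "(\<integral>\<^sup>+i. indicator {..<(prior_scale Type_A \<gamma> (fst i))\<^sup>2} s \<partial>count_space (Sigma L Z))
    \<le> ennreal (3 * s powr (- 1 / (2 * \<gamma> + 1)))"
proof -
  define y where "y = s powr (- 1 / (2 * \<gamma> + 1))"
  have y: "1 \<le> y"
    unfolding y_def using s \<gamma> powr_mono2'[of "- 1 / (2 * \<gamma> + 1)" s 1] by simp
  have e: "- (2 * \<gamma> + 1) * (- 1 / (2 * \<gamma> + 1)) = 1"
    using \<gamma> by (simp add: field_simps)
  have abs_le: "\<bar>of_int l\<bar> \<le> y" if "s < (prior_scale Type_A \<gamma> l)\<^sup>2" for l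
  proof (cases "l = 0")
    case False
    have "(- 1 / 2 - \<gamma>) + (- 1 / 2 - \<gamma>) = - (2 * \<gamma> + 1)"
      by simp
    then have "(prior_scale Type_A \<gamma> l)\<^sup>2 = \<bar>of_int l\<bar> powr (- (2 * \<gamma> + 1))"
      using False
      by (simp only: prior_scale_def power2_eq_square basis_type.case if_False powr_add[symmetric])
    \<comment> \<open>The exponent is negative, so taking powers reverses the inequality.\<close>
    then have "(\<bar>of_int l\<bar> powr (- (2 * \<gamma> + 1))) powr (- 1 / (2 * \<gamma> + 1)) \<le> y"
      unfolding y_def using that s \<gamma> by (intro powr_mono2') auto
    then show ?thesis
      using False by (simp only: powr_powr e) simp
  qed (use y in simp)
  have "(\<integral>\<^sup>+i. indicator {..<(prior_scale Type_A \<gamma> (fst i))\<^sup>2} s \<partial>count_space (Sigma L Z))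
      = (\<integral>\<^sup>+l. indicator {..<(prior_scale Type_A \<gamma> l)\<^sup>2} s * emeasure (count_space UNIV) (Z l) \<partial>count_space L)"
    by (rule nn_integral_count_space_Sigma_fst)
  also have "\<dots> \<le> (\<integral>\<^sup>+l. indicator {l. \<bar>of_int l\<bar> \<le> y} l \<partial>count_space UNIV)"
  proof -
    have "emeasure (count_space UNIV) (Z l) = 1" if "l \<in> L" for l
      using Z that by (subst emeasure_count_space_finite) (auto intro: card_ge_0_finite)
    then show ?thesis
      using abs_le
      by (subst nn_integral_count_space_indicator[of L], simp)
        (auto intro!: nn_integral_mono simp del: nn_integral_indicator split: split_indicator)
  qed
  also have "\<dots> = ennreal (real (card {l::int. \<bar>of_int l\<bar> \<le> y}))"
    using y card_int_abs_le(1)[of y] by (simp add: emeasure_count_space_finite ennreal_of_nat_eq_real_of_nat)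
  also have "\<dots> \<le> ennreal (3 * y)"
    using y card_int_abs_le(2)[of y] by (intro ennreal_leI) auto
  finally show ?thesis by (simp add: y_def)
qed

text \<open>A squared scale above \<open>s\<close> forces \<open>2 ^ l \<le> y\<close>, so the level
  is at most \<open>N\<close>. Level \<open>l\<close> has \<open>2 ^ l\<close> indices, and the
  geometric sum up to \<open>N\<close> is dominated by its last term: it is at most
  \<open>2 * 2 ^ N \<le> 2 * y\<close>. The constant 3 agrees with the one for the other type of
  basis.\<close>

lemma count_prior_scale_Type_B:
  fixes \<gamma> s :: real
  assumes \<gamma>: "0 < \<gamma>" and s: "0 < s" "s < 1"
    and L: "L \<subseteq> {1..}" and Z: "\<forall>l\<in>L. card (Z l) = 2 ^ nat l"
  shows "(\<integral>\<^sup>+i. indicator {..<(prior_scale Type_B \<gamma> (fst i))\<^sup>2} s \<partial>count_space (Sigma L Z))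
    \<le> ennreal (3 * s powr (- 1 / (2 * \<gamma> + 1)))"
proof -
  define y where "y = s powr (- 1 / (2 * \<gamma> + 1))"
  have y: "1 \<le> y"
    unfolding y_def using s \<gamma> powr_mono2'[of "- 1 / (2 * \<gamma> + 1)" s 1] by simp
  have e: "- (2 * \<gamma> + 1) * (- 1 / (2 * \<gamma> + 1)) = 1"
    using \<gamma> by (simp add: field_simps)
  define N where "N = nat \<lfloor>log 2 y\<rfloor>"
  have N: "l \<le> int N" if "l \<in> L" "s < (prior_scale Type_B \<gamma> l)\<^sup>2" for l
  proof -
    have "- (1 / 2 + \<gamma>) * of_int l + - (1 / 2 + \<gamma>) * of_int l = of_int l * - (2 * \<gamma> + 1)"
      by (simp add: algebra_simps)
    then have "(prior_scale Type_B \<gamma> l)\<^sup>2 = 2 powr (of_int l * - (2 * \<gamma> + 1))"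
      by (simp only: prior_scale_def power2_eq_square basis_type.case powr_add[symmetric])
    then have "(2 powr (of_int l * - (2 * \<gamma> + 1))) powr (- 1 / (2 * \<gamma> + 1)) \<le> y"
      unfolding y_def using that s \<gamma> by (intro powr_mono2') auto
    then have "2 powr of_int l \<le> y"
      by (simp only: powr_powr e mult.assoc) simp
    then have "of_int l \<le> log 2 y"
      using y by (simp add: le_log_iff)
    then show ?thesis
      unfolding N_def by linarith
  qed
  have "2 ^ N \<le> y"
  proof -
    have "real N \<le> log 2 y"
      unfolding N_def using y by simp
    then show ?thesis
      using y by (simp add: le_log_iff powr_realpow)
  qed
  have "(\<integral>\<^sup>+i. indicator {..<(prior_scale Type_B \<gamma> (fst i))\<^sup>2} s \<partial>count_space (Sigma L Z))
      = (\<integral>\<^sup>+l. indicator {..<(prior_scale Type_B \<gamma> l)\<^sup>2} s * emeasure (count_space UNIV) (Z l) \<partial>count_space L)"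
    by (rule nn_integral_count_space_Sigma_fst)
  also have "\<dots> = (\<integral>\<^sup>+l. indicator {..<(prior_scale Type_B \<gamma> l)\<^sup>2} s * 2 ^ nat l \<partial>count_space L)"
  proof (intro nn_integral_cong)
    fix l assume "l \<in> space (count_space L)"
    then have "finite (Z l)" "card (Z l) = 2 ^ nat l"
      using Z by (auto intro: card_ge_0_finite)
    then show "indicator {..<(prior_scale Type_B \<gamma> l)\<^sup>2} s * emeasure (count_space UNIV) (Z l)
        = (indicator {..<(prior_scale Type_B \<gamma> l)\<^sup>2} s * 2 ^ nat l :: ennreal)"
      by (simp add: emeasure_count_space_finite)
  qed
  also have "\<dots> \<le> (\<integral>\<^sup>+l. 2 ^ nat l * indicator (int ` {..N}) l \<partial>count_space UNIV)"
  proof -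
    \<comment> \<open>Levels are positive, so \<open>nat l\<close> recovers \<open>l\<close>. The
      image also contains level 0, which can only enlarge the sum.\<close>
    have "l \<in> int ` {..N}" if "l \<in> L" "s < (prior_scale Type_B \<gamma> l)\<^sup>2" for l
      using N[OF that] L that(1) by (intro image_eqI[of _ _ "nat l"]) auto
    then show ?thesis
      by (subst nn_integral_count_space_indicator[of L], simp)
        (auto intro!: nn_integral_mono split: split_indicator)
  qed
  also have "\<dots> = (\<integral>\<^sup>+l. 2 ^ nat l \<partial>count_space (int ` {..N}))"
    by (rule nn_integral_count_space_indicator[symmetric]) simp
  also have "\<dots> = ennreal (\<Sum>k\<le>N. 2 ^ k)"
    by (subst nn_integral_count_space_finite) (auto simp: sum.reindex sum_ennreal[symmetric] ennreal_power[symmetric] simp del: sum_ennreal)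
  also have "(\<Sum>k\<le>N. 2 ^ k) \<le> (2 * 2 ^ N :: real)"
    by (induction N) auto
  also have "\<dots> \<le> 3 * y"
    using \<open>2 ^ N \<le> y\<close> y by simp
  finally show ?thesis
    by (simp add: y_def ennreal_leI)
qed

subsection \<open>The risk of one coordinate\<close>

lemma nn_integral_has_bochner_integral:
  "has_bochner_integral M f x \<Longrightarrow> (\<And>t. 0 \<le> f t) \<Longrightarrow> (\<integral>\<^sup>+t. ennreal (f t) \<partial>M) = ennreal x"
  by (auto simp: has_bochner_integral_iff intro: nn_integral_eq_integral)

text \<open>Up to the factor \<open>sqrt (2 * pi)\<close>, the kernel is the normal density with
  mean \<open>z\<close> and variance 1. The bound then follows from
  \<open>u\<^sup>2 \<le> 2 * (u - z)\<^sup>2 + 2 * z\<^sup>2\<close>.\<close>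

lemma gaussian_second_moment_le:
  "(\<integral>\<^sup>+u. ennreal (u\<^sup>2 * exp (- (z - u)\<^sup>2 / 2)) \<partial>lborel) \<le> ennreal (2 * sqrt (2 * pi) * (1 + z\<^sup>2))"
proof -
  have m2: "has_bochner_integral lborel (\<lambda>u. normal_density z 1 u * (u - z)\<^sup>2) 1"
    using normal_moment_even[of 1 z 1] by simp
  have m0: "has_bochner_integral lborel (\<lambda>u. normal_density z 1 u) 1"
    using normal_moment_even[of 1 z 0] by simp
  have nd: "exp (- (z - u)\<^sup>2 / 2) = sqrt (2 * pi) * normal_density z 1 u" for u
    by (simp add: normal_density_def power2_commute[of z u])
  have "u\<^sup>2 * exp (- (z - u)\<^sup>2 / 2)
      \<le> sqrt (2 * pi) * (2 * (normal_density z 1 u * (u - z)\<^sup>2) + 2 * z\<^sup>2 * normal_density z 1 u)" for u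
  proof -
    have "u\<^sup>2 \<le> 2 * (u - z)\<^sup>2 + 2 * z\<^sup>2"
      using zero_le_power2[of "u - 2 * z"] by (simp add: power2_eq_square algebra_simps)
    then have "u\<^sup>2 * normal_density z 1 u \<le> (2 * (u - z)\<^sup>2 + 2 * z\<^sup>2) * normal_density z 1 u"
      by (intro mult_right_mono) auto
    then have "sqrt (2 * pi) * (u\<^sup>2 * normal_density z 1 u)
        \<le> sqrt (2 * pi) * ((2 * (u - z)\<^sup>2 + 2 * z\<^sup>2) * normal_density z 1 u)"
      by (intro mult_left_mono) auto
    then show ?thesis
      unfolding nd by (simp add: algebra_simps)
  qed
  then have "(\<integral>\<^sup>+u. ennreal (u\<^sup>2 * exp (- (z - u)\<^sup>2 / 2)) \<partial>lborel)
      \<le> (\<integral>\<^sup>+u. ennreal (sqrt (2 * pi) * (2 * (normal_density z 1 u * (u - z)\<^sup>2)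
          + 2 * z\<^sup>2 * normal_density z 1 u)) \<partial>lborel)"
    by (intro nn_integral_mono ennreal_leI)
  also have "\<dots> = ennreal (sqrt (2 * pi) * (2 * 1 + 2 * z\<^sup>2 * 1))"
    using m2 m0
    by (intro nn_integral_has_bochner_integral has_bochner_integral_mult_right has_bochner_integral_add) auto
  finally show ?thesis
    by (simp add: algebra_simps)
qed

text \<open>This integral arises from averaging over the noise when the prior scale is large.
  Splitting at 0 and rescaling by \<open>a\<close> reduces it to the integrals of
  \<open>x ^ m * exp (- x)\<close> over the half-line for \<open>m = 0\<close> and
  \<open>m = 2\<close>.\<close>

lemma laplace_second_moment_finite:
  assumes "0 < (a::real)"
  shows "(\<integral>\<^sup>+z. ennreal ((1 + z\<^sup>2) * exp (- a * \<bar>z\<bar>)) \<partial>lborel) < \<infinity>"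
proof -
  define f where "f z = ennreal ((1 + z\<^sup>2) * exp (- a * z)) * indicator {0..} z" for z :: real
  have [measurable]: "f \<in> borel_measurable borel"
    unfolding f_def[abs_def] by measurable
  have "f (0 + (1 / a) * x) = ennreal (x ^ 0 * exp (- x)) * indicator {0..} x
      + ennreal (1 / a\<^sup>2) * (ennreal (x ^ 2 * exp (- x)) * indicator {0..} x)" for x
    using assms unfolding f_def
    by (auto split: split_indicator simp: zero_le_divide_iff power_divide algebra_simps
        ennreal_mult[symmetric] ennreal_plus[symmetric] simp del: ennreal_plus)
  then have "(\<integral>\<^sup>+x. f (0 + (1 / a) * x) \<partial>lborel) = ennreal (real (fact 0)) + ennreal (1 / a\<^sup>2) * ennreal (real (fact 2))"
    using nn_intergal_power_times_exp_Ici[of 0] nn_intergal_power_times_exp_Ici[of 2]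
    by (simp add: nn_integral_add nn_integral_cmult)
  then have "(\<integral>\<^sup>+x. f (0 + (1 / a) * x) \<partial>lborel) < \<infinity>"
    by (simp add: ennreal_mult_less_top)
  then have f: "(\<integral>\<^sup>+x. f x \<partial>lborel) < \<infinity>"
    using assms by (subst nn_integral_real_affine[of f "1 / a" 0]) (auto simp: ennreal_mult_less_top)
  have "(\<integral>\<^sup>+x. f (- x) \<partial>lborel) = (\<integral>\<^sup>+x. f x \<partial>lborel)"
    using nn_integral_real_affine[of f "- 1" 0] by simp
  moreover have "(\<integral>\<^sup>+z. ennreal ((1 + z\<^sup>2) * exp (- a * \<bar>z\<bar>)) \<partial>lborel) \<le> (\<integral>\<^sup>+z. f z + f (- z) \<partial>lborel)"
    by (intro nn_integral_mono) (auto simp: f_def abs_if split: split_indicator)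
  ultimately have "(\<integral>\<^sup>+z. ennreal ((1 + z\<^sup>2) * exp (- a * \<bar>z\<bar>)) \<partial>lborel)
      \<le> (\<integral>\<^sup>+x. f x \<partial>lborel) + (\<integral>\<^sup>+x. f x \<partial>lborel)"
    by (simp add: nn_integral_add)
  also have "\<dots> < \<infinity>"
    using f by simp
  finally show ?thesis .
qed

text \<open>The prior shape is separated from the basis, the truth, the scale and the sample size.
  The constants in the risk bounds depend only on the parameters of the locale, which makes the
  one-dimensional bounds uniform over all coordinates and all sample sizes.\<close>

locale product_prior_density =
  fixes \<phi> :: "real \<Rightarrow> real" and M \<tau> c C :: real
  assumes \<phi>_measurable [measurable]: "\<phi> \<in> borel_measurable borel"
    and \<phi>_nonneg: "\<And>x. 0 \<le> \<phi> x"
    and \<phi>_prob: "(\<integral>\<^sup>+x. ennreal (\<phi> x) \<partial>lborel) = 1"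
    and M_pos: "0 < M" and \<tau>: "M < \<tau>" and c_pos: "0 < c"
    and \<phi>_upper: "\<And>x. \<phi> x \<le> C" and \<phi>_lower: "\<And>x. x \<in> {-\<tau><..<\<tau>} \<Longrightarrow> c \<le> \<phi> x"
    and \<phi>_moment: "integrable lborel (\<lambda>x. x\<^sup>2 * \<phi> x)"
begin

text \<open>Half of the gap in \<open>M < \<tau>\<close>: if
  \<open>\<bar>\<theta>\<bar> \<le> M * \<sigma>\<close>, then every point within
  \<open>margin * \<sigma>\<close> of \<open>\<theta>\<close> still lies where the prior density is
  at least \<open>c / \<sigma>\<close>.\<close>

definition margin :: real where "margin = (\<tau> - M) / 2"

lemma margin_pos: "0 < margin"
  using \<tau> by (simp add: margin_def)

lemma C_nonneg: "0 \<le> C"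
  using \<phi>_nonneg[of 0] \<phi>_upper[of 0] by linarith

section \<open>The rescaled prior density\<close>

lemma prior_density_measurable [measurable]: "prior_density \<phi> \<sigma> \<in> borel_measurable borel"
  unfolding prior_density_def[abs_def] by measurable

lemma prior_density_nonneg: "0 < \<sigma> \<Longrightarrow> 0 \<le> prior_density \<phi> \<sigma> u"
  by (simp add: prior_density_def \<phi>_nonneg)

lemma prior_density_prob:
  assumes "0 < \<sigma>"
  shows "(\<integral>\<^sup>+u. ennreal (prior_density \<phi> \<sigma> u) \<partial>lborel) = 1"
proof -
  have "(\<integral>\<^sup>+u. ennreal (prior_density \<phi> \<sigma> u) \<partial>lborel)
      = ennreal \<sigma> * (\<integral>\<^sup>+u. ennreal (1 / \<sigma>) * ennreal (\<phi> u) \<partial>lborel)"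
    using assms
    by (subst nn_integral_real_affine[of _ \<sigma> 0])
       (auto simp: prior_density_def \<phi>_nonneg ennreal_mult'[symmetric])
  also have "\<dots> = ennreal \<sigma> * ennreal (1 / \<sigma>)"
    by (simp add: nn_integral_cmult \<phi>_prob)
  also have "\<dots> = 1"
    using assms by (simp add: ennreal_mult'[symmetric])
  finally show ?thesis .
qed

lemma prior_density_integrable:
  assumes "0 < \<sigma>"
  shows "integrable lborel (prior_density \<phi> \<sigma>)"
  using prior_density_prob[OF assms] prior_density_nonneg[OF assms]
  by (intro integrableI_bounded) auto

definition second_moment :: real where
  "second_moment = (\<integral>x. x\<^sup>2 * \<phi> x \<partial>lborel)"

lemma second_moment_nonneg: "0 \<le> second_moment"
  unfolding second_moment_def by (intro integral_nonneg_AE) (simp add: \<phi>_nonneg)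

text \<open>After rescaling by \<open>\<sigma>\<close>, the square is split into
  \<open>2 * (\<sigma> * x)\<^sup>2\<close> and \<open>2 * \<theta>\<^sup>2\<close>. Both are of
  order \<open>\<sigma>\<^sup>2\<close>: the first by the moment assumption, the second by the bound
  on the truth.\<close>

lemma prior_second_moment_le:
  assumes "0 < \<sigma>" "\<bar>\<theta>\<bar> \<le> M * \<sigma>"
  shows "(\<integral>\<^sup>+u. ennreal ((u - \<theta>)\<^sup>2 * prior_density \<phi> \<sigma> u) \<partial>lborel)
    \<le> ennreal (2 * (second_moment + M\<^sup>2) * \<sigma>\<^sup>2)"
proof -
  have "(\<integral>\<^sup>+u. ennreal ((u - \<theta>)\<^sup>2 * prior_density \<phi> \<sigma> u) \<partial>lborel)
      = ennreal \<sigma> * (\<integral>\<^sup>+x. ennreal ((\<sigma> * x - \<theta>)\<^sup>2 * prior_density \<phi> \<sigma> (\<sigma> * x)) \<partial>lborel)"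
    using assms by (subst nn_integral_real_affine[of _ \<sigma> 0]) auto
  also have "\<dots> \<le> ennreal \<sigma> * (\<integral>\<^sup>+x. ennreal (2 * \<sigma> * (x\<^sup>2 * \<phi> x) + 2 * M\<^sup>2 * \<sigma> * \<phi> x) \<partial>lborel)"
  proof (intro mult_left_mono nn_integral_mono ennreal_leI)
    fix x
    have "(\<sigma> * x - \<theta>)\<^sup>2 \<le> 2 * (\<sigma> * x)\<^sup>2 + 2 * \<theta>\<^sup>2"
      using zero_le_power2[of "\<sigma> * x + \<theta>"] by (simp add: power2_eq_square algebra_simps)
    also have "\<theta>\<^sup>2 \<le> (M * \<sigma>)\<^sup>2"
      using assms(2) by (metis abs_ge_zero power2_abs power_mono)
    finally have "(\<sigma> * x - \<theta>)\<^sup>2 * (\<phi> x / \<sigma>) \<le> (2 * (\<sigma> * x)\<^sup>2 + 2 * (M * \<sigma>)\<^sup>2) * (\<phi> x / \<sigma>)"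
      using assms(1) by (intro mult_right_mono) (auto simp: \<phi>_nonneg)
    also have "\<dots> = 2 * \<sigma> * (x\<^sup>2 * \<phi> x) + 2 * M\<^sup>2 * \<sigma> * \<phi> x"
      using assms(1) by (simp add: power2_eq_square field_simps)
    finally show "(\<sigma> * x - \<theta>)\<^sup>2 * prior_density \<phi> \<sigma> (\<sigma> * x) \<le> 2 * \<sigma> * (x\<^sup>2 * \<phi> x) + 2 * M\<^sup>2 * \<sigma> * \<phi> x"
      using assms(1) by (simp add: prior_density_def)
  qed simp
  also have "(\<integral>\<^sup>+x. ennreal (2 * \<sigma> * (x\<^sup>2 * \<phi> x) + 2 * M\<^sup>2 * \<sigma> * \<phi> x) \<partial>lborel)
      = ennreal (2 * \<sigma> * second_moment + 2 * M\<^sup>2 * \<sigma> * 1)"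
  proof (intro nn_integral_has_bochner_integral has_bochner_integral_mult_right has_bochner_integral_add)
    show "has_bochner_integral lborel (\<lambda>x. x\<^sup>2 * \<phi> x) second_moment"
      unfolding second_moment_def by (rule has_bochner_integral_integrable[OF \<phi>_moment])
    show "has_bochner_integral lborel \<phi> 1"
      using \<phi>_prob by (intro has_bochner_integral_nn_integral) (auto simp: \<phi>_nonneg)
  qed (use assms(1) \<phi>_nonneg second_moment_nonneg in auto)
  also have "ennreal \<sigma> * ennreal (2 * \<sigma> * second_moment + 2 * M\<^sup>2 * \<sigma> * 1)
      = ennreal (2 * (second_moment + M\<^sup>2) * \<sigma>\<^sup>2)"
    using assms(1) by (simp add: ennreal_mult'[symmetric] power2_eq_square algebra_simps)
  finally show ?thesis .
qed

section \<open>Lower bounds for the normalising constant of the posterior\<close>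

definition evidence :: "nat \<Rightarrow> real \<Rightarrow> real \<Rightarrow> real" where
  "evidence n \<sigma> x = (\<integral>v. exp (- real n * (x - v)\<^sup>2 / 2) * prior_density \<phi> \<sigma> v \<partial>lborel)"

lemma evidence_measurable [measurable]: "evidence n \<sigma> \<in> borel_measurable borel"
  unfolding evidence_def[abs_def] by measurable

lemma evidence_integrable:
  assumes "0 < \<sigma>"
  shows "integrable lborel (\<lambda>v. exp (- real n * (x - v)\<^sup>2 / 2) * prior_density \<phi> \<sigma> v)"
proof (rule Bochner_Integration.integrable_bound[OF prior_density_integrable[OF assms]])
  have "exp (- real n * (x - v)\<^sup>2 / 2) \<le> 1" for v
    by simp
  then have "exp (- real n * (x - v)\<^sup>2 / 2) * prior_density \<phi> \<sigma> v \<le> 1 * prior_density \<phi> \<sigma> v" for v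
    by (intro mult_right_mono prior_density_nonneg assms)
  then show "AE v in lborel. norm (exp (- real n * (x - v)\<^sup>2 / 2) * prior_density \<phi> \<sigma> v)
      \<le> norm (prior_density \<phi> \<sigma> v)"
    using prior_density_nonneg[OF assms] by (simp add: abs_mult)
qed measurable

text \<open>
  The factor growing with \<open>\<bar>x - \<theta>\<bar>\<close> comes from integrating only over points on the same side of
  \<open>\<theta>\<close> as \<open>x\<close>. Without it, the resulting bound on the posterior risk would just fail to be
  integrable against the Gaussian noise.
\<close>

lemma evidence_ge:
  assumes \<sigma>: "0 < \<sigma>" and \<theta>: "\<bar>\<theta>\<bar> \<le> M * \<sigma>" and \<delta>: "0 < \<delta>" "\<delta> \<le> margin * \<sigma>"
  shows "c / \<sigma> * (\<delta> / 2) * exp (- real n * ((x - \<theta>)\<^sup>2 - \<delta> * \<bar>x - \<theta>\<bar> + \<delta>\<^sup>2) / 2) \<le> evidence n \<sigma> x"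
proof -
  \<comment> \<open>The points at distance between \<open>\<delta> / 2\<close> and
    \<open>\<delta>\<close> from \<open>\<theta>\<close>, on the side where \<open>x\<close> lies.
    There \<open>v - \<theta>\<close> and \<open>x - \<theta>\<close> do not have opposite signs, so
    the cross term in \<open>(x - v)\<^sup>2\<close> gains at least
    \<open>\<delta> * \<bar>x - \<theta>\<bar>\<close>.\<close>
  define W where "W = (if \<theta> \<le> x then {\<theta> + \<delta> / 2..\<theta> + \<delta>} else {\<theta> - \<delta>..\<theta> - \<delta> / 2})"
  let ?K = "exp (- real n * ((x - \<theta>)\<^sup>2 - \<delta> * \<bar>x - \<theta>\<bar> + \<delta>\<^sup>2) / 2) * (c / \<sigma>)"
  have [measurable]: "W \<in> sets borel"
    by (simp add: W_def)
  have W: "emeasure lborel W = ennreal (\<delta> / 2)"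
    using \<delta> by (simp add: W_def)
  have K: "?K \<le> exp (- real n * (x - v)\<^sup>2 / 2) * prior_density \<phi> \<sigma> v" if "v \<in> W" for v
  proof (rule mult_mono)
    have v: "\<delta> / 2 \<le> \<bar>v - \<theta>\<bar>" "\<bar>v - \<theta>\<bar> \<le> \<delta>"
      "(v - \<theta>) * (x - \<theta>) = \<bar>v - \<theta>\<bar> * \<bar>x - \<theta>\<bar>"
      using that \<delta> by (auto simp: W_def abs_if algebra_simps split: if_splits)
    have "\<delta> / 2 * \<bar>x - \<theta>\<bar> \<le> (v - \<theta>) * (x - \<theta>)"
      unfolding v(3) using v(1) by (rule mult_right_mono) simp
    moreover have "(v - \<theta>)\<^sup>2 \<le> \<delta>\<^sup>2"
      using power_mono[OF v(2), of 2] by simp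
    ultimately have "(x - v)\<^sup>2 \<le> (x - \<theta>)\<^sup>2 - \<delta> * \<bar>x - \<theta>\<bar> + \<delta>\<^sup>2"
      by (simp add: power2_eq_square algebra_simps)
    then show "exp (- real n * ((x - \<theta>)\<^sup>2 - \<delta> * \<bar>x - \<theta>\<bar> + \<delta>\<^sup>2) / 2) \<le> exp (- real n * (x - v)\<^sup>2 / 2)"
      by (simp add: mult_left_mono)
    have "\<bar>v\<bar> \<le> M * \<sigma> + margin * \<sigma>"
      using v(2) \<theta> \<delta>(2) by linarith
    also have "\<dots> < \<tau> * \<sigma>"
      unfolding distrib_right[symmetric] using \<tau> \<sigma> by (intro mult_strict_right_mono) (simp add: margin_def field_simps)
    finally have "\<bar>v / \<sigma>\<bar> < \<tau>"
      using \<sigma> by (simp add: abs_divide divide_less_eq)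
    then have "v / \<sigma> \<in> {-\<tau><..<\<tau>}"
      unfolding greaterThanLessThan_iff by linarith
    then have "c \<le> \<phi> (v / \<sigma>)"
      by (rule \<phi>_lower)
    then show "c / \<sigma> \<le> prior_density \<phi> \<sigma> v"
      using \<sigma> by (simp add: prior_density_def divide_right_mono)
  qed (use c_pos \<sigma> in auto)
  have "c / \<sigma> * (\<delta> / 2) * exp (- real n * ((x - \<theta>)\<^sup>2 - \<delta> * \<bar>x - \<theta>\<bar> + \<delta>\<^sup>2) / 2)
      = (\<integral>v. indicator W v *\<^sub>R ?K \<partial>lborel)"
    using W \<delta> by (simp add: measure_def mult_ac)
  also have "\<dots> \<le> evidence n \<sigma> x"
    unfolding evidence_def
  proof (rule integral_mono)
    show "integrable lborel (\<lambda>v. indicator W v *\<^sub>R ?K)"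
      using W by (intro integrable_scaleR_left integrable_real_indicator) auto
    show "indicator W v *\<^sub>R ?K \<le> exp (- real n * (x - v)\<^sup>2 / 2) * prior_density \<phi> \<sigma> v" for v
      using K[of v] prior_density_nonneg[OF \<sigma>, of v] by (auto split: split_indicator)
  qed (rule evidence_integrable[OF \<sigma>])
  finally show ?thesis .
qed

lemma evidence_pos:
  assumes "0 < \<sigma>"
  shows "0 < evidence n \<sigma> x"
proof (rule less_le_trans)
  \<comment> \<open>This is \<open>evidence_ge\<close> at \<open>\<theta> = 0\<close> with the
    largest admissible \<open>\<delta>\<close>.\<close>
  show "c / \<sigma> * (margin * \<sigma> / 2)
      * exp (- real n * ((x - 0)\<^sup>2 - margin * \<sigma> * \<bar>x - 0\<bar> + (margin * \<sigma>)\<^sup>2) / 2) \<le> evidence n \<sigma> x"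
    using assms M_pos margin_pos by (intro evidence_ge) auto
qed (use assms c_pos margin_pos in simp)

lemma coord_posterior_eq:
  "coord_posterior n (prior_density \<phi> \<sigma>) x = density lborel (\<lambda>u. ennreal
     (exp (- real n * (x - u)\<^sup>2 / 2) * prior_density \<phi> \<sigma> u / evidence n \<sigma> x))"
  by (simp add: coord_posterior_def evidence_def)

lemma prob_space_coord_posterior:
  assumes "0 < \<sigma>"
  shows "prob_space (coord_posterior n (prior_density \<phi> \<sigma>) x)"
proof
  have "(\<integral>\<^sup>+u. ennreal (exp (- real n * (x - u)\<^sup>2 / 2) * prior_density \<phi> \<sigma> u / evidence n \<sigma> x) \<partial>lborel)
      = ennreal (\<integral>u. exp (- real n * (x - u)\<^sup>2 / 2) * prior_density \<phi> \<sigma> u / evidence n \<sigma> x \<partial>lborel)"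
    using evidence_integrable[OF assms, of n x] evidence_pos[OF assms, of n x] prior_density_nonneg[OF assms]
    by (intro nn_integral_eq_integral) auto
  also have "\<dots> = 1"
    using evidence_pos[OF assms, of n x] by (simp add: evidence_def)
  finally show "emeasure (coord_posterior n (prior_density \<phi> \<sigma>) x)
      (space (coord_posterior n (prior_density \<phi> \<sigma>) x)) = 1"
    unfolding coord_posterior_eq by (simp add: emeasure_density)
qed

lemma sets_coord_posterior [simp]: "sets (coord_posterior n p x) = sets borel"
  by (simp add: coord_posterior_def)

lemma coord_loss_eq:
  assumes "0 < \<sigma>"
  shows "(\<integral>\<^sup>+u. ennreal ((u - \<theta>)\<^sup>2) \<partial>coord_posterior n (prior_density \<phi> \<sigma>) x)
    = (\<integral>\<^sup>+u. ennreal ((u - \<theta>)\<^sup>2 * (exp (- real n * (x - u)\<^sup>2 / 2) * prior_density \<phi> \<sigma> u) / evidence n \<sigma> x) \<partial>lborel)"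
  unfolding coord_posterior_eq
  using evidence_pos[OF assms, of n x] prior_density_nonneg[OF assms]
  by (subst nn_integral_density) (simp_all add: ennreal_mult'[symmetric] mult_ac)

lemma coord_loss_measurable:
  assumes "0 < \<sigma>"
  shows "(\<lambda>x. \<integral>\<^sup>+u. ennreal ((u - \<theta>)\<^sup>2) \<partial>coord_posterior n (prior_density \<phi> \<sigma>) x) \<in> borel_measurable borel"
  unfolding coord_loss_eq[OF assms] by measurable

text \<open>The factor that \<open>evidence_ge\<close> yields in both regimes:
  \<open>margin / 2\<close> stems from the length of the interval of integration, and
  \<open>exp (- margin\<^sup>2 / 2)\<close> from the term \<open>\<delta>\<^sup>2\<close> in the
  exponent.\<close>

definition evidence_const :: real where
  "evidence_const = c * margin / 2 * exp (- margin\<^sup>2 / 2)"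

lemma evidence_const_pos: "0 < evidence_const"
  using c_pos margin_pos by (simp add: evidence_const_def)

text \<open>Take \<open>\<delta> = margin * \<sigma>\<close>, so that
  \<open>real n * \<delta>\<^sup>2 \<le> margin\<^sup>2\<close>, and drop the gain from the cross
  term. With \<open>z\<close> the standardised noise, the remaining factor
  \<open>exp (- z\<^sup>2 / 2)\<close> is the likelihood of the truth.\<close>

lemma evidence_ge_small_scale:
  assumes "0 < n" "0 < \<sigma>" "\<bar>\<theta>\<bar> \<le> M * \<sigma>" "real n * \<sigma>\<^sup>2 \<le> 1"
  shows "evidence_const * exp (- z\<^sup>2 / 2) \<le> evidence n \<sigma> (\<theta> + z / sqrt (real n))"
proof -
  let ?\<delta> = "margin * \<sigma>" and ?x = "\<theta> + z / sqrt (real n)"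
  define Y where "Y = real n * ((?x - \<theta>)\<^sup>2 - ?\<delta> * \<bar>?x - \<theta>\<bar> + ?\<delta>\<^sup>2)"
  have "Y \<le> real n * ((?x - \<theta>)\<^sup>2 + ?\<delta>\<^sup>2)"
    unfolding Y_def using assms margin_pos by (intro mult_left_mono) auto
  also have "\<dots> = z\<^sup>2 + margin\<^sup>2 * (real n * \<sigma>\<^sup>2)"
    using assms(1) by (simp add: power_divide power_mult_distrib algebra_simps)
  also have "\<dots> \<le> z\<^sup>2 + margin\<^sup>2 * 1"
    using assms(4) by (intro add_left_mono mult_left_mono) auto
  finally have "exp (- margin\<^sup>2 / 2) * exp (- z\<^sup>2 / 2) \<le> exp (- Y / 2)"
    by (simp flip: exp_add)
  then have "c * margin / 2 * (exp (- margin\<^sup>2 / 2) * exp (- z\<^sup>2 / 2)) \<le> c * margin / 2 * exp (- Y / 2)"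
    using c_pos margin_pos by (intro mult_left_mono) auto
  also have "c * margin / 2 = c / \<sigma> * (?\<delta> / 2)"
    using assms by simp
  also have "\<dots> * exp (- Y / 2) \<le> evidence n \<sigma> ?x"
    using evidence_ge[of \<sigma> \<theta> ?\<delta> n ?x] assms(2,3) margin_pos unfolding Y_def by simp
  finally show ?thesis
    using assms(2) by (simp add: evidence_const_def)
qed

text \<open>Take \<open>\<delta> = margin / sqrt (real n)\<close>, which is admissible because
  \<open>sqrt (real n) * \<sigma> \<ge> 1\<close>. At this width the gain from the cross term is
  \<open>exp (margin * \<bar>z\<bar> / 2)\<close>, free of \<open>n\<close> and
  \<open>\<sigma>\<close>.\<close>

lemma evidence_ge_large_scale:
  assumes "0 < n" "0 < \<sigma>" "\<bar>\<theta>\<bar> \<le> M * \<sigma>" "1 \<le> real n * \<sigma>\<^sup>2"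
  shows "evidence_const / (\<sigma> * sqrt (real n)) * exp (margin * \<bar>z\<bar> / 2) * exp (- z\<^sup>2 / 2)
    \<le> evidence n \<sigma> (\<theta> + z / sqrt (real n))"
proof -
  let ?\<delta> = "margin / sqrt (real n)" and ?x = "\<theta> + z / sqrt (real n)"
  have "1\<^sup>2 \<le> (sqrt (real n) * \<sigma>)\<^sup>2"
    using assms(4) by (simp add: power_mult_distrib)
  then have "1 \<le> sqrt (real n) * \<sigma>"
    by (rule power2_le_imp_le) (use assms(2) in simp)
  then have "margin * 1 \<le> margin * (sqrt (real n) * \<sigma>)"
    using margin_pos by (intro mult_left_mono) auto
  then have \<delta>: "?\<delta> \<le> margin * \<sigma>"
    using assms(1) by (simp add: divide_le_eq mult_ac)
  have "(?x - \<theta>)\<^sup>2 - ?\<delta> * \<bar>?x - \<theta>\<bar> + ?\<delta>\<^sup>2 = (z\<^sup>2 - margin * \<bar>z\<bar> + margin\<^sup>2) / real n"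
    by (simp add: power_divide abs_divide diff_divide_distrib add_divide_distrib)
  then have "- real n * ((?x - \<theta>)\<^sup>2 - ?\<delta> * \<bar>?x - \<theta>\<bar> + ?\<delta>\<^sup>2) / 2
      = - margin\<^sup>2 / 2 + margin * \<bar>z\<bar> / 2 + - z\<^sup>2 / 2"
    using assms(1) by simp
  then have "exp (- real n * ((?x - \<theta>)\<^sup>2 - ?\<delta> * \<bar>?x - \<theta>\<bar> + ?\<delta>\<^sup>2) / 2)
      = exp (- margin\<^sup>2 / 2) * exp (margin * \<bar>z\<bar> / 2) * exp (- z\<^sup>2 / 2)"
    by (simp only: exp_add)
  then show ?thesis
    using evidence_ge[OF assms(2,3) _ \<delta>, of n ?x] margin_pos assms(1)
    by (simp add: evidence_const_def mult_ac)
qed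

end

section \<open>The expected posterior loss of one coordinate\<close>

lemma gaussian_kernel_shift:
  assumes "0 < n"
  shows "exp (- real n * (\<theta> + z / sqrt (real n) - u)\<^sup>2 / 2) = exp (- (z - sqrt (real n) * (u - \<theta>))\<^sup>2 / 2)"
proof -
  have "z - sqrt (real n) * (u - \<theta>) = sqrt (real n) * (\<theta> + z / sqrt (real n) - u)"
    using assms by (simp add: algebra_simps)
  then have "(z - sqrt (real n) * (u - \<theta>))\<^sup>2 = real n * (\<theta> + z / sqrt (real n) - u)\<^sup>2"
    by (simp add: power_mult_distrib)
  then show ?thesis by simp
qed

context product_prior_density
begin

definition coord_risk :: "nat \<Rightarrow> real \<Rightarrow> real \<Rightarrow> ennreal" where
  "coord_risk n \<sigma> \<theta> = (\<integral>\<^sup>+z. (\<integral>\<^sup>+u. ennreal ((u - \<theta>)\<^sup>2)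
     \<partial>coord_posterior n (prior_density \<phi> \<sigma>) (\<theta> + z / sqrt (real n))) \<partial>density lborel std_normal_density)"

text \<open>In this form, a double integral over the standardised noise \<open>z\<close> and the
  parameter \<open>u\<close>, the evidence can be bounded pointwise and the order of integration
  exchanged.\<close>

lemma coord_risk_eq:
  assumes "0 < n" "0 < \<sigma>"
  shows "coord_risk n \<sigma> \<theta> = (\<integral>\<^sup>+z. (\<integral>\<^sup>+u. ennreal (std_normal_density z *
    ((u - \<theta>)\<^sup>2 * (exp (- (z - sqrt (real n) * (u - \<theta>))\<^sup>2 / 2) * prior_density \<phi> \<sigma> u)
      / evidence n \<sigma> (\<theta> + z / sqrt (real n)))) \<partial>lborel) \<partial>lborel)"
proof -
  have "coord_risk n \<sigma> \<theta> = (\<integral>\<^sup>+z. ennreal (std_normal_density z) * (\<integral>\<^sup>+u. ennreal ((u - \<theta>)\<^sup>2)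
     \<partial>coord_posterior n (prior_density \<phi> \<sigma>) (\<theta> + z / sqrt (real n))) \<partial>lborel)"
    unfolding coord_risk_def
    by (intro nn_integral_density) (auto intro: measurable_compose[OF _ coord_loss_measurable[OF assms(2)]])
  also have "\<dots> = (\<integral>\<^sup>+z. (\<integral>\<^sup>+u. ennreal (std_normal_density z) * ennreal
      ((u - \<theta>)\<^sup>2 * (exp (- (z - sqrt (real n) * (u - \<theta>))\<^sup>2 / 2) * prior_density \<phi> \<sigma> u)
        / evidence n \<sigma> (\<theta> + z / sqrt (real n))) \<partial>lborel) \<partial>lborel)"
    unfolding coord_loss_eq[OF assms(2)] gaussian_kernel_shift[OF assms(1)]
    by (intro nn_integral_cong nn_integral_cmult[symmetric]) measurable
  finally show ?thesis
    by (simp only: ennreal_mult'[OF normal_density_nonneg, symmetric])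
qed

lemma std_normal_density_eq: "std_normal_density z = exp (- z\<^sup>2 / 2) / sqrt (2 * pi)"
  by (simp add: normal_density_def)

definition risk_const_small :: real where
  "risk_const_small = 2 * (second_moment + M\<^sup>2) / evidence_const"

text \<open>The lower bound for the evidence cancels the Gaussian factor of the noise density. The
  likelihood, read as a function of \<open>z\<close>, is a multiple of the normal density centred at
  \<open>sqrt (real n) * (u - \<theta>)\<close>, so integrating over \<open>z\<close> first removes
  it and leaves the second moment of the prior around \<open>\<theta>\<close>.\<close>

lemma coord_risk_small_scale:
  assumes "0 < n" "0 < \<sigma>" "\<bar>\<theta>\<bar> \<le> M * \<sigma>" "real n * \<sigma>\<^sup>2 \<le> 1"
  shows "coord_risk n \<sigma> \<theta> \<le> ennreal (risk_const_small * \<sigma>\<^sup>2)"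
proof -
  let ?p = "prior_density \<phi> \<sigma>"
  have "coord_risk n \<sigma> \<theta> \<le> (\<integral>\<^sup>+z. (\<integral>\<^sup>+u. ennreal ((u - \<theta>)\<^sup>2 * ?p u / evidence_const)
      * ennreal (normal_density (sqrt (real n) * (u - \<theta>)) 1 z) \<partial>lborel) \<partial>lborel)"
    unfolding coord_risk_eq[OF assms(1,2)]
  proof (intro nn_integral_mono)
    fix z u :: real
    let ?k = "exp (- (z - sqrt (real n) * (u - \<theta>))\<^sup>2 / 2)" and ?E = "evidence n \<sigma> (\<theta> + z / sqrt (real n))"
    have "std_normal_density z / ?E \<le> std_normal_density z / (evidence_const * exp (- z\<^sup>2 / 2))"
      using evidence_ge_small_scale[OF assms] evidence_const_pos evidence_pos[OF assms(2)]
      by (intro divide_left_mono) auto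
    also have "\<dots> = 1 / (evidence_const * sqrt (2 * pi))"
      by (simp add: std_normal_density_eq)
    finally have "(u - \<theta>)\<^sup>2 * ?k * ?p u * (std_normal_density z / ?E)
        \<le> (u - \<theta>)\<^sup>2 * ?k * ?p u * (1 / (evidence_const * sqrt (2 * pi)))"
      using prior_density_nonneg[OF assms(2)] by (intro mult_left_mono) auto
    moreover have "normal_density (sqrt (real n) * (u - \<theta>)) 1 z = ?k / sqrt (2 * pi)"
      by (simp add: normal_density_def)
    ultimately show "ennreal (std_normal_density z * ((u - \<theta>)\<^sup>2 * (?k * ?p u) / ?E))
        \<le> ennreal ((u - \<theta>)\<^sup>2 * ?p u / evidence_const) * ennreal (normal_density (sqrt (real n) * (u - \<theta>)) 1 z)"
      using prior_density_nonneg[OF assms(2), of u] evidence_const_pos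
      by (simp add: ennreal_mult'[symmetric] ennreal_leI mult_ac)
  qed
  also have "\<dots> = (\<integral>\<^sup>+u. (\<integral>\<^sup>+z. ennreal ((u - \<theta>)\<^sup>2 * ?p u / evidence_const)
      * ennreal (normal_density (sqrt (real n) * (u - \<theta>)) 1 z) \<partial>lborel) \<partial>lborel)"
    by (intro lborel_pair.Fubini') (simp add: normal_density_def)
  also have "\<dots> = (\<integral>\<^sup>+u. ennreal (1 / evidence_const) * ennreal ((u - \<theta>)\<^sup>2 * ?p u) \<partial>lborel)"
  proof (intro nn_integral_cong)
    fix u
    have "(\<integral>\<^sup>+z. ennreal (normal_density (sqrt (real n) * (u - \<theta>)) 1 z) \<partial>lborel) = 1"
      by (subst nn_integral_eq_integral) auto
    then show "(\<integral>\<^sup>+z. ennreal ((u - \<theta>)\<^sup>2 * ?p u / evidence_const)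
        * ennreal (normal_density (sqrt (real n) * (u - \<theta>)) 1 z) \<partial>lborel)
        = ennreal (1 / evidence_const) * ennreal ((u - \<theta>)\<^sup>2 * ?p u)"
      using evidence_const_pos by (simp add: nn_integral_cmult ennreal_mult'[symmetric])
  qed
  also have "\<dots> = ennreal (1 / evidence_const) * (\<integral>\<^sup>+u. ennreal ((u - \<theta>)\<^sup>2 * ?p u) \<partial>lborel)"
    by (intro nn_integral_cmult) measurable
  also have "\<dots> \<le> ennreal (1 / evidence_const) * ennreal (2 * (second_moment + M\<^sup>2) * \<sigma>\<^sup>2)"
    by (intro mult_left_mono prior_second_moment_le assms(2,3)) simp
  also have "\<dots> = ennreal (risk_const_small * \<sigma>\<^sup>2)"
    using evidence_const_pos by (simp add: ennreal_mult'[symmetric] risk_const_small_def)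
  finally show ?thesis .
qed

text \<open>The integral is finite by \<open>laplace_second_moment_finite\<close>, so
  \<open>enn2real\<close> returns its true value.\<close>

definition risk_const_large :: real where
  "risk_const_large = 2 * C / evidence_const *
     enn2real (\<integral>\<^sup>+z. ennreal ((1 + z\<^sup>2) * exp (- (margin / 2) * \<bar>z\<bar>)) \<partial>lborel)"

text \<open>Substitute \<open>v = sqrt (real n) * (u - \<theta>)\<close>: the differential
  contributes \<open>1 / sqrt (real n)\<close> and the square contributes
  \<open>1 / real n\<close>.\<close>

lemma likelihood_second_moment_le:
  assumes "0 < n"
  shows "(\<integral>\<^sup>+u. ennreal ((u - \<theta>)\<^sup>2 * exp (- (z - sqrt (real n) * (u - \<theta>))\<^sup>2 / 2)) \<partial>lborel)
    \<le> ennreal (2 * sqrt (2 * pi) * (1 + z\<^sup>2) / (real n * sqrt (real n)))"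
proof -
  let ?s = "sqrt (real n)"
  have "(\<integral>\<^sup>+u. ennreal ((u - \<theta>)\<^sup>2 * exp (- (z - ?s * (u - \<theta>))\<^sup>2 / 2)) \<partial>lborel)
      = ennreal (1 / ?s) * (\<integral>\<^sup>+v. ennreal (1 / real n) * ennreal (v\<^sup>2 * exp (- (z - v)\<^sup>2 / 2)) \<partial>lborel)"
    using assms
    by (subst nn_integral_real_affine[of _ "1 / ?s" \<theta>])
       (auto simp: power_divide ennreal_mult'[symmetric] intro!: arg_cong2[where f = "(*)"] nn_integral_cong)
  also have "\<dots> = ennreal (1 / ?s) * (ennreal (1 / real n) * (\<integral>\<^sup>+v. ennreal (v\<^sup>2 * exp (- (z - v)\<^sup>2 / 2)) \<partial>lborel))"
    by (subst nn_integral_cmult) auto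
  also have "\<dots> \<le> ennreal (1 / ?s) * (ennreal (1 / real n) * ennreal (2 * sqrt (2 * pi) * (1 + z\<^sup>2)))"
    by (intro mult_left_mono gaussian_second_moment_le) auto
  also have "\<dots> = ennreal (2 * sqrt (2 * pi) * (1 + z\<^sup>2) / (real n * ?s))"
    by (simp add: ennreal_mult'[symmetric] mult_ac)
  finally show ?thesis .
qed

text \<open>The prior density is at most \<open>C / \<sigma>\<close> and the evidence at least of
  order \<open>1 / (\<sigma> * sqrt (real n))\<close>, so \<open>\<sigma>\<close> cancels and a
  factor \<open>sqrt (real n)\<close> remains. The second moment of the likelihood turns it into
  \<open>1 / real n\<close>. The noise density cancels too, and it is the gain from the cross term,
  now \<open>exp (- (margin / 2) * \<bar>z\<bar>)\<close>, that makes the integral over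
  \<open>z\<close> converge.\<close>

lemma coord_risk_large_scale:
  assumes "0 < n" "0 < \<sigma>" "\<bar>\<theta>\<bar> \<le> M * \<sigma>" "1 \<le> real n * \<sigma>\<^sup>2"
  shows "coord_risk n \<sigma> \<theta> \<le> ennreal (risk_const_large / real n)"
proof -
  let ?p = "prior_density \<phi> \<sigma>" and ?s = "sqrt (real n)"
  let ?k = "\<lambda>z u. exp (- (z - ?s * (u - \<theta>))\<^sup>2 / 2)"
  let ?e = "\<lambda>z. C * ?s / (evidence_const * sqrt (2 * pi)) * exp (- (margin / 2) * \<bar>z\<bar>)"
  have e_nonneg: "0 \<le> ?e z" for z
    using C_nonneg evidence_const_pos by simp
  have "coord_risk n \<sigma> \<theta> \<le> (\<integral>\<^sup>+z. (\<integral>\<^sup>+u. ennreal (?e z) * ennreal ((u - \<theta>)\<^sup>2 * ?k z u) \<partial>lborel) \<partial>lborel)"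
    unfolding coord_risk_eq[OF assms(1,2)]
  proof (intro nn_integral_mono)
    fix z u :: real
    let ?E = "evidence n \<sigma> (\<theta> + z / ?s)"
    have "std_normal_density z / ?E
        \<le> std_normal_density z / (evidence_const / (\<sigma> * ?s) * exp (margin * \<bar>z\<bar> / 2) * exp (- z\<^sup>2 / 2))"
      using evidence_ge_large_scale[OF assms] evidence_const_pos evidence_pos[OF assms(2)] assms(1,2)
      by (intro divide_left_mono) auto
    also have "\<dots> = \<sigma> * ?s / (evidence_const * sqrt (2 * pi)) * exp (- (margin / 2) * \<bar>z\<bar>)"
      by (simp add: std_normal_density_eq exp_minus field_simps)
    finally have "?p u * (std_normal_density z / ?E)
        \<le> C / \<sigma> * (\<sigma> * ?s / (evidence_const * sqrt (2 * pi)) * exp (- (margin / 2) * \<bar>z\<bar>))"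
      using evidence_pos[OF assms(2)] C_nonneg assms(2) \<phi>_upper
      by (intro mult_mono) (auto simp: prior_density_def divide_right_mono less_imp_le)
    also have "\<dots> = ?e z"
      using assms(2) by simp
    finally have "(u - \<theta>)\<^sup>2 * ?k z u * (?p u * (std_normal_density z / ?E)) \<le> (u - \<theta>)\<^sup>2 * ?k z u * ?e z"
      by (intro mult_left_mono) auto
    then show "ennreal (std_normal_density z * ((u - \<theta>)\<^sup>2 * (?k z u * ?p u) / ?E))
        \<le> ennreal (?e z) * ennreal ((u - \<theta>)\<^sup>2 * ?k z u)"
      unfolding ennreal_mult'[OF e_nonneg, symmetric] by (intro ennreal_leI) (simp add: mult_ac)
  qed
  also have "\<dots> = (\<integral>\<^sup>+z. ennreal (?e z) * (\<integral>\<^sup>+u. ennreal ((u - \<theta>)\<^sup>2 * ?k z u) \<partial>lborel) \<partial>lborel)"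
    by (intro nn_integral_cong nn_integral_cmult) measurable
  also have "\<dots> \<le> (\<integral>\<^sup>+z. ennreal (?e z) * ennreal (2 * sqrt (2 * pi) * (1 + z\<^sup>2) / (real n * ?s)) \<partial>lborel)"
    by (intro nn_integral_mono mult_left_mono likelihood_second_moment_le assms(1)) simp
  also have "\<dots> = (\<integral>\<^sup>+z. ennreal (2 * C / evidence_const / real n)
      * ennreal ((1 + z\<^sup>2) * exp (- (margin / 2) * \<bar>z\<bar>)) \<partial>lborel)"
  proof (intro nn_integral_cong)
    fix z
    have "?e z * (2 * sqrt (2 * pi) * (1 + z\<^sup>2) / (real n * ?s))
        = 2 * C / evidence_const / real n * ((1 + z\<^sup>2) * exp (- (margin / 2) * \<bar>z\<bar>))"
      using assms(1) by simp
    moreover have "0 \<le> 2 * C / evidence_const / real n"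
      using C_nonneg evidence_const_pos by simp
    ultimately show "ennreal (?e z) * ennreal (2 * sqrt (2 * pi) * (1 + z\<^sup>2) / (real n * ?s))
        = ennreal (2 * C / evidence_const / real n) * ennreal ((1 + z\<^sup>2) * exp (- (margin / 2) * \<bar>z\<bar>))"
      by (simp only: ennreal_mult'[symmetric] e_nonneg)
  qed
  also have "\<dots> = ennreal (2 * C / evidence_const / real n)
      * (\<integral>\<^sup>+z. ennreal ((1 + z\<^sup>2) * exp (- (margin / 2) * \<bar>z\<bar>)) \<partial>lborel)"
    by (intro nn_integral_cmult) measurable
  also have "\<dots> = ennreal (2 * C / evidence_const / real n)
      * ennreal (enn2real (\<integral>\<^sup>+z. ennreal ((1 + z\<^sup>2) * exp (- (margin / 2) * \<bar>z\<bar>)) \<partial>lborel))"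
    using laplace_second_moment_finite[of "margin / 2"] margin_pos by (subst ennreal_enn2real) auto
  also have "\<dots> = ennreal (risk_const_large / real n)"
    using C_nonneg evidence_const_pos
    by (subst ennreal_mult'[symmetric]) (auto simp: risk_const_large_def)
  finally show ?thesis .
qed

definition risk_const :: real where
  "risk_const = max risk_const_small risk_const_large"

lemma risk_const_nonneg: "0 \<le> risk_const"
  unfolding risk_const_def risk_const_small_def
  using second_moment_nonneg evidence_const_pos by (intro max.coboundedI1) simp

lemma coord_risk_le:
  assumes "0 < n" "0 < \<sigma>" "\<bar>\<theta>\<bar> \<le> M * \<sigma>"
  shows "coord_risk n \<sigma> \<theta> \<le> ennreal (risk_const * min (\<sigma>\<^sup>2) (1 / real n))"
proof (cases "real n * \<sigma>\<^sup>2 \<le> 1")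
  case True
  then have "min (\<sigma>\<^sup>2) (1 / real n) = \<sigma>\<^sup>2"
    using assms(1) by (intro min.absorb1) (simp add: le_divide_eq mult.commute)
  moreover have "risk_const_small * \<sigma>\<^sup>2 \<le> risk_const * \<sigma>\<^sup>2"
    by (intro mult_right_mono) (simp_all add: risk_const_def)
  ultimately show ?thesis
    using order_trans[OF coord_risk_small_scale[OF assms True] ennreal_leI] by simp
next
  case False
  then have "min (\<sigma>\<^sup>2) (1 / real n) = 1 / real n"
    using assms(1) by (intro min.absorb2) (simp add: divide_le_eq mult.commute)
  moreover have "risk_const_large / real n \<le> risk_const / real n"
    by (intro divide_right_mono) (simp_all add: risk_const_def)
  moreover have "1 \<le> real n * \<sigma>\<^sup>2"
    using False by simp
  ultimately show ?thesis
    using order_trans[OF coord_risk_large_scale[OF assms] ennreal_leI] by simp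
qed

end

subsection \<open>Integration over the coordinates\<close>

lemma nn_integral_PiM_component:
  assumes "\<And>i. i \<in> I \<Longrightarrow> prob_space (N i)" "i \<in> I" "f \<in> borel_measurable (N i)"
  shows "(\<integral>\<^sup>+\<omega>. f (\<omega> i) \<partial>PiM I N) = (\<integral>\<^sup>+x. f x \<partial>N i)"
proof -
  have "(\<integral>\<^sup>+x. f x \<partial>N i) = (\<integral>\<^sup>+x. f x \<partial>distr (PiM I N) (N i) (\<lambda>\<omega>. \<omega> i))"
    using distr_PiM_component[of I N i] assms by simp
  also have "\<dots> = (\<integral>\<^sup>+\<omega>. f (\<omega> i) \<partial>PiM I N)"
    using assms by (intro nn_integral_distr measurable_component_singleton) auto
  finally show ?thesis by simp
qed

lemma sets_data_law [measurable_cong]: "sets (data_law I \<psi> n f) = sets (PiM I (\<lambda>_. borel))"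
  by (simp add: data_law_def)

lemma nn_integral_data_law_component:
  assumes i: "i \<in> I" and g: "g \<in> borel_measurable borel"
  shows "(\<integral>\<^sup>+X. g (X i) \<partial>data_law I \<psi> n f)
    = (\<integral>\<^sup>+z. g (Re (L2_inner f (\<psi> i)) + z / sqrt (real n)) \<partial>density lborel std_normal_density)"
proof -
  let ?N = "\<lambda>_ :: 'a. density lborel std_normal_density"
  have component: "(\<lambda>\<epsilon>. \<epsilon> j) \<in> borel_measurable (PiM I ?N)" if "j \<in> I" for j
    using measurable_component_singleton[OF that, of ?N] by simp
  have data: "(\<lambda>\<epsilon>. \<lambda>i\<in>I. Re (L2_inner f (\<psi> i)) + \<epsilon> i / sqrt (real n)) \<in> PiM I ?N \<rightarrow>\<^sub>M PiM I (\<lambda>_. borel)"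
    by (intro measurable_restrict borel_measurable_add borel_measurable_divide component) auto
  have "(\<lambda>X. g (X i)) \<in> borel_measurable (PiM I (\<lambda>_. borel))"
    by (rule measurable_compose[OF measurable_component_singleton[OF i] g])
  then have "(\<integral>\<^sup>+X. g (X i) \<partial>data_law I \<psi> n f)
      = (\<integral>\<^sup>+\<epsilon>. g ((\<lambda>i\<in>I. Re (L2_inner f (\<psi> i)) + \<epsilon> i / sqrt (real n)) i) \<partial>PiM I ?N)"
    unfolding data_law_def by (intro nn_integral_distr[OF data]) simp
  also have "\<dots> = (\<integral>\<^sup>+\<epsilon>. g (Re (L2_inner f (\<psi> i)) + \<epsilon> i / sqrt (real n)) \<partial>PiM I ?N)"
    using i by simp
  also have "\<dots> = (\<integral>\<^sup>+z. g (Re (L2_inner f (\<psi> i)) + z / sqrt (real n)) \<partial>?N i)"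
    using g i
    by (intro nn_integral_PiM_component[where f = "\<lambda>z. g (Re (L2_inner f (\<psi> i)) + z / sqrt (real n))"]
        prob_space_normal_density) simp_all
  finally show ?thesis .
qed

text \<open>\<open>sq_loss\<close> is replaced by the sum over coordinates before anything is
  exchanged, as \<open>nn_integral\<close> is monotone for arbitrary integrands. The sum is then
  moved out of the posterior integral and out of the data integral, and in each summand the product
  measures reduce to a single factor.\<close>

lemma (in product_prior_density) posterior_risk_le_sum:
  assumes basis: "orthonormal_basis (Sigma L Z) \<psi>" and f0: "f0 \<in> L2" and "0 < n"
    and real: "\<And>i. i \<in> Sigma L Z \<Longrightarrow> L2_inner f0 (\<psi> i) \<in> \<real>"
    and \<sigma>: "\<And>l. 0 < \<sigma> l"
    and bound: "\<And>i. i \<in> Sigma L Z \<Longrightarrow> \<bar>Re (L2_inner f0 (\<psi> i))\<bar> \<le> M * \<sigma> (fst i)"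
  shows "posterior_risk L Z \<psi> \<sigma> \<phi> f0 n
    \<le> (\<integral>\<^sup>+i. ennreal (risk_const * min ((\<sigma> (fst i))\<^sup>2) (1 / real n)) \<partial>count_space (Sigma L Z))"
proof -
  let ?I = "Sigma L Z"
  define \<theta>\<^sub>0 where "\<theta>\<^sub>0 i = Re (L2_inner f0 (\<psi> i))" for i
  define g where "g i x = (\<integral>\<^sup>+u. ennreal ((u - \<theta>\<^sub>0 i)\<^sup>2)
    \<partial>coord_posterior n (prior_density \<phi> (\<sigma> (fst i))) x)" for i x
  have g: "g i \<in> borel_measurable borel" for i
    unfolding g_def[abs_def] by (rule coord_loss_measurable[OF \<sigma>])
  have inner: "(\<integral>\<^sup>+\<theta>. sq_loss ?I \<psi> f0 \<theta> \<partial>posterior L Z \<sigma> \<phi> n X) \<le> (\<integral>\<^sup>+i. g i (X i) \<partial>count_space ?I)" for X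
  proof -
    let ?N = "\<lambda>i. coord_posterior n (prior_density \<phi> (\<sigma> (fst i))) (X i)"
    have "(\<integral>\<^sup>+\<theta>. sq_loss ?I \<psi> f0 \<theta> \<partial>PiM ?I ?N)
        \<le> (\<integral>\<^sup>+\<theta>. (\<integral>\<^sup>+i. ennreal ((\<theta> i - \<theta>\<^sub>0 i)\<^sup>2) \<partial>count_space ?I) \<partial>PiM ?I ?N)"
      using real by (intro nn_integral_mono sq_loss_le_coeffs[OF basis _ f0]) (auto simp: \<theta>\<^sub>0_def)
    also have "\<dots> = (\<integral>\<^sup>+i. (\<integral>\<^sup>+\<theta>. ennreal ((\<theta> i - \<theta>\<^sub>0 i)\<^sup>2) \<partial>PiM ?I ?N) \<partial>count_space ?I)"
    proof (rule nn_integral_count_space_nn_integral)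
      fix i assume "i \<in> ?I"
      then have "(\<lambda>\<theta>. \<theta> i) \<in> borel_measurable (PiM ?I ?N)"
        using measurable_component_singleton[of i ?I ?N] by (simp cong: measurable_cong_sets)
      then show "(\<lambda>\<theta>. ennreal ((\<theta> i - \<theta>\<^sub>0 i)\<^sup>2)) \<in> borel_measurable (PiM ?I ?N)"
        by measurable
    qed simp
    also have "\<dots> = (\<integral>\<^sup>+i. g i (X i) \<partial>count_space ?I)"
    proof (rule nn_integral_cong)
      fix i assume "i \<in> space (count_space ?I)"
      then have "i \<in> ?I" by simp
      then show "(\<integral>\<^sup>+\<theta>. ennreal ((\<theta> i - \<theta>\<^sub>0 i)\<^sup>2) \<partial>PiM ?I ?N) = g i (X i)"
        unfolding g_def
        by (intro nn_integral_PiM_component[where f = "\<lambda>u. ennreal ((u - \<theta>\<^sub>0 i)\<^sup>2)"]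
            prob_space_coord_posterior \<sigma>) (simp_all cong: measurable_cong_sets)
    qed
    finally show ?thesis
      by (simp add: posterior_def)
  qed
  have "posterior_risk L Z \<psi> \<sigma> \<phi> f0 n \<le> (\<integral>\<^sup>+X. (\<integral>\<^sup>+i. g i (X i) \<partial>count_space ?I) \<partial>data_law ?I \<psi> n f0)"
    unfolding posterior_risk_def by (intro nn_integral_mono inner)
  also have "\<dots> = (\<integral>\<^sup>+i. (\<integral>\<^sup>+X. g i (X i) \<partial>data_law ?I \<psi> n f0) \<partial>count_space ?I)"
  proof (rule nn_integral_count_space_nn_integral)
    fix i assume "i \<in> ?I"
    from measurable_compose[OF measurable_component_singleton[OF this] g]
    show "(\<lambda>X. g i (X i)) \<in> borel_measurable (data_law ?I \<psi> n f0)"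
      by (simp cong: measurable_cong_sets add: sets_data_law)
  qed simp
  \<comment> \<open>The posterior of a coordinate depends on the data through that coordinate alone,
    which is the truth plus standard normal noise divided by \<open>sqrt (real n)\<close>.\<close>
  also have "\<dots> = (\<integral>\<^sup>+i. coord_risk n (\<sigma> (fst i)) (\<theta>\<^sub>0 i) \<partial>count_space ?I)"
    by (intro nn_integral_cong)
      (simp add: nn_integral_data_law_component[OF _ g] flip: \<theta>\<^sub>0_def, simp add: coord_risk_def g_def)
  also have "\<dots> \<le> (\<integral>\<^sup>+i. ennreal (risk_const * min ((\<sigma> (fst i))\<^sup>2) (1 / real n)) \<partial>count_space ?I)"
    using bound by (intro nn_integral_mono coord_risk_le \<open>0 < n\<close> \<sigma>) (auto simp: \<theta>\<^sub>0_def)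
  finally show ?thesis .
qed

section \<open>The convergence rate\<close>

lemma prior_scale_pos: "0 < prior_scale T \<gamma> l"
  by (simp add: prior_scale_def split: basis_type.split)

text \<open>Both types of basis satisfy the same counting bound, with exponent
  \<open>- 1 / (2 * \<gamma> + 1)\<close>. Integrating it up to \<open>1 / real n\<close> raises the
  exponent by one, to \<open>2 * \<gamma> / (2 * \<gamma> + 1)\<close>.\<close>

lemma sum_min_prior_scale_le:
  fixes \<gamma> :: real
  assumes basis: "S_regular_basis T S L Z \<psi>" and \<gamma>: "0 < \<gamma>" and n: "0 < n"
  shows "(\<integral>\<^sup>+i. ennreal (min ((prior_scale T \<gamma> (fst i))\<^sup>2) (1 / real n)) \<partial>count_space (Sigma L Z))
    \<le> ennreal (3 * ((2 * \<gamma> + 1) / (2 * \<gamma>)) * real n powr (- 2 * \<gamma> / (2 * \<gamma> + 1)))"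
proof -
  let ?p = "- 1 / (2 * \<gamma> + 1)"
  have p1: "?p + 1 = 2 * \<gamma> / (2 * \<gamma> + 1)"
    using \<gamma> by (simp add: field_simps)
  have "(\<integral>\<^sup>+i. ennreal (min ((prior_scale T \<gamma> (fst i))\<^sup>2) (1 / real n)) \<partial>count_space (Sigma L Z))
    \<le> ennreal (3 * ((1 / real n) powr (?p + 1) / (?p + 1)))"
  proof (rule sum_min_le_of_count_le)
    show "- 1 < ?p"
      using \<gamma> by (simp add: field_simps)
    fix s :: real
    assume s: "0 < s" "s < 1 / real n"
    \<comment> \<open>The counting bounds are stated for thresholds below 1.\<close>
    then have "s < 1"
      using n by (auto intro: less_le_trans)
    with s(1) \<gamma> basis
      count_prior_scale_Type_A[of \<gamma> s L Z] count_prior_scale_Type_B[of \<gamma> s L Z]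
    show "(\<integral>\<^sup>+i. indicator {..<(prior_scale T \<gamma> (fst i))\<^sup>2} s \<partial>count_space (Sigma L Z)) \<le> ennreal (3 * s powr ?p)"
      unfolding S_regular_basis_def
      by (cases T) auto
  qed auto
  also have "(1 / real n) powr (?p + 1) = real n powr (- 2 * \<gamma> / (2 * \<gamma> + 1))"
    unfolding p1 using n by (simp add: powr_divide powr_minus_divide)
  also have "3 * (real n powr (- 2 * \<gamma> / (2 * \<gamma> + 1)) / (?p + 1))
      = 3 * ((2 * \<gamma> + 1) / (2 * \<gamma>)) * real n powr (- 2 * \<gamma> / (2 * \<gamma> + 1))"
    unfolding p1 by simp
  finally show ?thesis .
qed

text \<open>Finiteness is asserted separately because \<open>enn2real\<close> sends \<infinity> to
  0: the order bound by itself would not exclude an infinite risk.\<close>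

theorem corollary3:
  fixes T :: basis_type and S :: nat
    and L :: "int set" and Z :: "int \<Rightarrow> int set"
    and \<psi> :: "int \<times> int \<Rightarrow> real \<Rightarrow> complex"
    and f0 :: "real \<Rightarrow> complex"
    and \<phi> :: "real \<Rightarrow> real"
    and \<gamma> M \<tau> c C :: real
  assumes S: "S \<ge> 1"
    and basis: "S_regular_basis T S L Z \<psi>"
    and \<gamma>: "\<gamma> > 0"
    and f0: "f0 \<in> L2"
    and f0_real: "\<forall>l\<in>L. \<forall>k\<in>Z l. L2_inner f0 (\<psi> (l, k)) \<in> \<real>"
    and \<phi>_density: "\<phi> \<in> borel_measurable borel" "\<forall>x. \<phi> x \<ge> 0"
      "(\<integral>\<^sup>+x. ennreal (\<phi> x) \<partial>lborel) = 1"
    and M: "M > 0"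
    and P1: "\<forall>l\<in>L. \<forall>k\<in>Z l. \<bar>Re (L2_inner f0 (\<psi> (l, k)))\<bar> / prior_scale T \<gamma> l \<le> M"
    and P2_consts: "\<tau> > M" "0 < c" "c \<le> C"
    and P2_upper: "\<forall>x. \<phi> x \<le> C"
    and P2_lower: "\<forall>x\<in>{-\<tau><..<\<tau>}. \<phi> x \<ge> c"
    and P2_moment: "integrable lborel (\<lambda>x. x\<^sup>2 * \<phi> x)"
  shows "(\<forall>\<^sub>F n in sequentially. posterior_risk L Z \<psi> (prior_scale T \<gamma>) \<phi> f0 n < \<infinity>) \<and>
         (\<lambda>n. enn2real (posterior_risk L Z \<psi> (prior_scale T \<gamma>) \<phi> f0 n))
           \<in> O(\<lambda>n. real n powr (- 2 * \<gamma> / (2 * \<gamma> + 1)))"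
proof -
  interpret product_prior_density \<phi> M \<tau> c C
    using \<phi>_density M P2_consts P2_upper P2_lower P2_moment by unfold_locales auto
  define K where "K = risk_const * (3 * ((2 * \<gamma> + 1) / (2 * \<gamma>)))"
  have le: "posterior_risk L Z \<psi> (prior_scale T \<gamma>) \<phi> f0 n
      \<le> ennreal (K * real n powr (- 2 * \<gamma> / (2 * \<gamma> + 1)))" if "0 < n" for n
  proof -
    have "posterior_risk L Z \<psi> (prior_scale T \<gamma>) \<phi> f0 n
        \<le> (\<integral>\<^sup>+i. ennreal (risk_const * min ((prior_scale T \<gamma> (fst i))\<^sup>2) (1 / real n)) \<partial>count_space (Sigma L Z))"
    proof (rule posterior_risk_le_sum)
      show "\<bar>Re (L2_inner f0 (\<psi> i))\<bar> \<le> M * prior_scale T \<gamma> (fst i)" if "i \<in> Sigma L Z" for i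
        using P1 that prior_scale_pos[of T \<gamma> "fst i"] by (auto simp: divide_le_eq split: if_splits)
    qed (use basis f0 f0_real that prior_scale_pos in \<open>auto simp: S_regular_basis_def\<close>)
    also have "\<dots> = ennreal risk_const *
        (\<integral>\<^sup>+i. ennreal (min ((prior_scale T \<gamma> (fst i))\<^sup>2) (1 / real n)) \<partial>count_space (Sigma L Z))"
      by (simp add: ennreal_mult' risk_const_nonneg nn_integral_cmult)
    also have "\<dots> \<le> ennreal risk_const *
        ennreal (3 * ((2 * \<gamma> + 1) / (2 * \<gamma>)) * real n powr (- 2 * \<gamma> / (2 * \<gamma> + 1)))"
      by (intro mult_left_mono sum_min_prior_scale_le[OF basis \<gamma> that]) simp
    also have "\<dots> = ennreal (K * real n powr (- 2 * \<gamma> / (2 * \<gamma> + 1)))"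
      by (simp only: K_def mult.assoc ennreal_mult'[OF risk_const_nonneg])
    finally show ?thesis .
  qed
  have "\<forall>\<^sub>F n in sequentially. posterior_risk L Z \<psi> (prior_scale T \<gamma>) \<phi> f0 n < \<infinity>"
    using eventually_gt_at_top[of 0] by eventually_elim (auto intro: le_less_trans[OF le])
  moreover have "(\<lambda>n. enn2real (posterior_risk L Z \<psi> (prior_scale T \<gamma>) \<phi> f0 n))
      \<in> O(\<lambda>n. real n powr (- 2 * \<gamma> / (2 * \<gamma> + 1)))"
  proof (rule bigoI[of _ K])
    have "0 \<le> K"
      using risk_const_nonneg \<gamma> by (simp add: K_def)
    show "\<forall>\<^sub>F n in sequentially. norm (enn2real (posterior_risk L Z \<psi> (prior_scale T \<gamma>) \<phi> f0 n))
        \<le> K * norm (real n powr (- 2 * \<gamma> / (2 * \<gamma> + 1)))"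
      using eventually_gt_at_top[of 0]
    proof eventually_elim
      case (elim n)
      then show ?case
        using enn2real_mono[OF le[OF elim]] \<open>0 \<le> K\<close> by simp
    qed
  qed
  ultimately show ?thesis ..
qed

end
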